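(* For every graph class $\mathcal C$ with VC density at most $1$, Connected $k$-Vertex Cover restricted to input graphs in $\mathcal C$ admits a kernel whose output graph has $O(k^{1.5})$ vertices.
   Context: A graph class $\mathcal C$ has VC density at most $1$ if there is a constant $c$ such that for every $G\in\mathcal C$ and every $X\subseteq V(G)$, $|\{N(v)\cap X : v\in V(G)\}|\le c\,|X|$ (with $N(v)$ the open neighbourhood). Connected $k$-Vertex Cover: given a graph $G$ and integer $k$ (parameter), decide whether $G$ has a vertex cover $S$ with $|S|\le k$ and $G[S]$ connected. A kernel is a polynomial-time algorithm mapping an instance $(G,k)$ to an equivalent instance of the same problem of size bounded by a function of $k$. *)

theory Defs
  imports
    "Graph_Theory.Graph_Theory"
    "HOL-Computational_Algebra.Polynomial"
    "HOL-Library.Landau_Symbols"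
    "HOL-Library.Log_Nat"
begin

section \<open>Connected vertex covers and VC density\<close>

text \<open>
  A finite simple graph is a symmetric loop-free finite digraph without parallel arcs, i.e.\ a
  \<open>pair_graph\<close>.  As usual for graphs that serve as inputs of algorithms, a graph on \<open>n\<close>
  vertices has the vertex set \<open>{0..<n}\<close>.  Classes of such graphs are not assumed to be closed
  under isomorphism or under taking induced subgraphs.
\<close>

type_synonym ngraph = "nat pair_pre_digraph"

definition simple_graph :: "ngraph \<Rightarrow> bool" where
  "simple_graph G \<longleftrightarrow> pair_graph G \<and> (\<exists>n. pverts G = {0..<n})"

definition nbhd :: "ngraph \<Rightarrow> nat \<Rightarrow> nat set" where
  "nbhd G v = {u. (v, u) \<in> parcs G}"

text \<open>
  The empty set \<open>X\<close> has to be excluded: it has exactly one trace in every nonempty graph,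
  whereas the bound \<open>c * card X\<close> is \<open>0\<close>.
\<close>

definition vc_density_at_most_1 :: "ngraph set \<Rightarrow> bool" where
  "vc_density_at_most_1 \<C> \<longleftrightarrow>
     (\<exists>c::real. \<forall>G\<in>\<C>. \<forall>X. X \<subseteq> pverts G \<and> X \<noteq> {} \<longrightarrow>
        real (card {nbhd G v \<inter> X | v. v \<in> pverts G}) \<le> c * real (card X))"

definition vertex_cover :: "ngraph \<Rightarrow> nat set \<Rightarrow> bool" where
  "vertex_cover G S \<longleftrightarrow> S \<subseteq> pverts G \<and> (\<forall>(u, v)\<in>parcs G. u \<in> S \<or> v \<in> S)"

text \<open>
  Connectivity is that of the graph library, where the graph without vertices is not connected.
\<close>

definition connected_vertex_cover_problem :: "(ngraph \<times> nat) set" where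
  "connected_vertex_cover_problem =
     {(G, k). \<exists>S. vertex_cover G S \<and> card S \<le> k \<and>
        Digraph_Component.connected (with_proj G \<restriction> S)}"

section \<open>Random access machines\<close>

text \<open>
  Polynomial time refers to a random access machine with unit costs and the instruction set
  of addition and truncated subtraction, which is polynomially equivalent to Turing machines
  (Cook and Reckhow, Time bounded random access machines, 1973); multiplication is deliberately
  absent.  The memory is divided into banks of cells that are addressed by natural numbers.
  Bank names are fixed in the program, addresses are computed.  Programs are structured, and
  every executed assignment and every evaluated test counts one step; the size of
  the expressions in a program does not depend on its input.
\<close>

type_synonym store = "nat \<Rightarrow> nat \<Rightarrow> nat"

datatype aexp =
    Const nat
  | Cell nat aexp
  | Add aexp aexp
  | Sub aexp aexp

primrec aval :: "aexp \<Rightarrow> store \<Rightarrow> nat" where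
  "aval (Const n) s = n"
| "aval (Cell b a) s = s b (aval a s)"
| "aval (Add a1 a2) s = aval a1 s + aval a2 s"
| "aval (Sub a1 a2) s = aval a1 s - aval a2 s"

datatype com =
    Skip
  | Upd nat aexp aexp
  | Seq com com
  | Cond aexp com com
  | While aexp com

text \<open>
  \<open>exec c s t s'\<close>: started in the store \<open>s\<close>, the program \<open>c\<close> halts after \<open>t\<close> steps in the
  store \<open>s'\<close>.  Tests ask whether the value of an expression is nonzero.
\<close>

inductive exec :: "com \<Rightarrow> store \<Rightarrow> nat \<Rightarrow> store \<Rightarrow> bool" where
  Skip: "exec Skip s 0 s"
| Upd: "exec (Upd b a e) s 1 (s(b := (s b)(aval a s := aval e s)))"
| Seq: "exec c1 s1 t1 s2 \<Longrightarrow> exec c2 s2 t2 s3 \<Longrightarrow> exec (Seq c1 c2) s1 (t1 + t2) s3"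
| CondTrue: "aval e s \<noteq> 0 \<Longrightarrow> exec c1 s t s' \<Longrightarrow> exec (Cond e c1 c2) s (t + 1) s'"
| CondFalse: "aval e s = 0 \<Longrightarrow> exec c2 s t s' \<Longrightarrow> exec (Cond e c1 c2) s (t + 1) s'"
| WhileFalse: "aval e s = 0 \<Longrightarrow> exec (While e c) s 1 s"
| WhileTrue: "aval e s1 \<noteq> 0 \<Longrightarrow> exec c s1 t1 s2 \<Longrightarrow> exec (While e c) s2 t2 s3 \<Longrightarrow>
    exec (While e c) s1 (t1 + t2 + 1) s3"

inductive_cases exec_cases:
  "exec Skip s t s'"
  "exec (Upd b a e) s t s'"
  "exec (Seq c1 c2) s t s'"
  "exec (Cond e c1 c2) s t s'"
  "exec (While e c) s t s'"

lemma exec_deterministic: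
  "exec c s t s' \<Longrightarrow> exec c s u s'' \<Longrightarrow> u = t \<and> s'' = s'"
proof (induction arbitrary: u s'' rule: exec.induct)
  case Skip
  then show ?case by (auto elim: exec_cases)
next
  case Upd
  then show ?case by (auto elim: exec_cases)
next
  case Seq
  from Seq.prems show ?case
    by (rule exec_cases(3)) (metis Seq.IH)
next
  case CondTrue
  from CondTrue.prems show ?case
    by (rule exec_cases(4)) (metis CondTrue.IH Suc_eq_plus1, metis CondTrue.hyps(1))
next
  case CondFalse
  from CondFalse.prems show ?case
    by (rule exec_cases(4)) (metis CondFalse.hyps(1) less_irrefl, metis CondFalse.IH Suc_eq_plus1)
next
  case WhileFalse
  from WhileFalse.prems WhileFalse.hyps show ?case
    by (auto elim: exec_cases(5))
next
  case WhileTrue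
  from WhileTrue.prems show ?case
    by (rule exec_cases(5)) (metis WhileTrue.hyps(1), metis WhileTrue.IH Suc_eq_plus1)
qed

section \<open>Instances and kernels\<close>

text \<open>
  Bank 0 holds the number of vertices and the parameter, bank 1 the adjacency matrix row by row.
  Initially all other cells are \<open>0\<close>; after the run all other cells are ignored.
\<close>

definition input_store :: "ngraph \<Rightarrow> nat \<Rightarrow> store" where
  "input_store G k = (\<lambda>b a.
     let n = card (pverts G) in
     if b = 0 \<and> a = 0 then n
     else if b = 0 \<and> a = 1 then k
     else if b = 1 \<and> a < n * n \<and> (a div n, a mod n) \<in> parcs G then 1
     else 0)"

definition output_in_store :: "store \<Rightarrow> ngraph \<Rightarrow> nat \<Rightarrow> bool" where
  "output_in_store s G k \<longleftrightarrow>
     s 0 0 = card (pverts G) \<and> s 0 1 = k \<and>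
     (\<forall>i < card (pverts G). \<forall>j < card (pverts G).
        s 1 (i * card (pverts G) + j) = (if (i, j) \<in> parcs G then 1 else 0))"

text \<open>
  The number of bits of the adjacency matrix and of the parameter in binary.
\<close>

definition instance_size :: "ngraph \<Rightarrow> nat \<Rightarrow> nat" where
  "instance_size G k = (card (pverts G))\<^sup>2 + floorlog 2 k"

text \<open>
  The program \<open>c\<close> is a kernel with at most \<open>g k\<close> vertices for the parameterized graph problem
  \<open>P\<close> restricted to input graphs in \<open>\<C>\<close>.  The restriction is a promise on the input; the
  output is an instance of \<open>P\<close>, and the size of the output including its parameter
  is bounded by a function \<open>f\<close> of the input parameter.
\<close>

definition kernel_with_vertices ::
    "com \<Rightarrow> (ngraph \<times> nat) set \<Rightarrow> ngraph set \<Rightarrow> (nat \<Rightarrow> nat) \<Rightarrow> bool" where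
  "kernel_with_vertices c P \<C> g \<longleftrightarrow>
     (\<exists>(p :: nat poly) (f :: nat \<Rightarrow> nat). \<forall>G\<in>\<C>. \<forall>k. \<exists>t s G' k'.
        exec c (input_store G k) t s \<and>
        t \<le> poly p (instance_size G k) \<and>
        simple_graph G' \<and> output_in_store s G' k' \<and>
        ((G', k') \<in> P \<longleftrightarrow> (G, k) \<in> P) \<and>
        instance_size G' k' \<le> f k \<and>
        card (pverts G') \<le> g k)"

end

(*
  In a graph with a connected vertex cover T of at most k vertices, the heavy vertices (those of
  degree more than k) belong to T, and at most c * k different neighbourhoods occur outside T.  Let
  t be the number of vertices outside T with neighbourhood X, and x the number of non-heavy
  vertices of X.  Keeping only x + 2 of these twins preserves the answer: were all of them in the
  cover and X not contained in it, then replacing all but one of them by X would yield a smaller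
  connected vertex cover.  Pendant neighbours force the heavy vertices into the cover even though
  their degrees may have dropped.

  Summed over all X, the products t * x count edges at non-heavy vertices of T, so they amount to at
  most k^2.  By the Cauchy-Schwarz inequality the sum of min t x over the at most c * k sets X is at
  most sqrt (c * k * k^2), which is O(k^1.5).  The program does not know T; it compares the square
  of the size of the reduced graph with D * k^3 and answers no if the bound is violated.
*)

theory Submission
  imports Defs "HOL-Analysis.Convex"
begin

text \<open>All classes of twins are trimmed at once, with ranks and heavy vertices taken in the
  original graph. The obstacle is that trimming one class might shrink the neighbourhoods of
  another, whose retained vertices would then no longer admit the exchange. This cannot happen: a
  removed vertex has no removed neighbour. The threshold ignores heavy neighbours because the
  exchange pays only for vertices not known in advance to lie in the cover. The size bound depends
  on this, as heavy vertices may have arbitrarily many neighbours and would spoil the edge count.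
  The exchange is applied to a minimum connected cover of the reduced graph. There it shows that the
  neighbourhood of a removed vertex is contained in the cover, so the edges at that vertex are
  covered in its absence. The reduced graph may lie outside the class. Density is invoked for the
  input graph alone, to show that an instance exceeding the size bound has no solution.\<close>

lemma simple_graph_iff:
  "simple_graph G \<longleftrightarrow> (\<exists>n. pverts G = {0..<n}) \<and> parcs G \<subseteq> pverts G \<times> pverts G \<and>
     sym (parcs G) \<and> irrefl (parcs G)"
proof
  assume "simple_graph G"
  then interpret pair_graph G
    by (simp add: simple_graph_def)
  have "sym (parcs G)"
    using sym_arcs by (simp add: symmetric_def)
  moreover have "irrefl (parcs G)"
    using pair_no_loops by (fastforce simp: irrefl_def)
  moreover have "parcs G \<subseteq> pverts G \<times> pverts G"
    by (auto dest: in_arcsD1 in_arcsD2)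
  ultimately show "(\<exists>n. pverts G = {0..<n}) \<and> parcs G \<subseteq> pverts G \<times> pverts G \<and>
     sym (parcs G) \<and> irrefl (parcs G)"
    using \<open>simple_graph G\<close> by (simp add: simple_graph_def)
next
  assume *: "(\<exists>n. pverts G = {0..<n}) \<and> parcs G \<subseteq> pverts G \<times> pverts G \<and>
     sym (parcs G) \<and> irrefl (parcs G)"
  then have "finite (parcs G)"
    by (auto intro: finite_subset)
  with * have "pair_graph G"
    by unfold_locales (auto simp: symmetric_def irrefl_def)
  with * show "simple_graph G"
    by (simp add: simple_graph_def)
qed

section \<open>Connectivity of vertex sets as reachability\<close>

definition connected_on :: "('a \<times> 'a) set \<Rightarrow> 'a set \<Rightarrow> bool" where
  "connected_on E S \<longleftrightarrow> S \<noteq> {} \<and> (\<forall>u\<in>S. \<forall>v\<in>S. (u, v) \<in> (E \<inter> S \<times> S)\<^sup>*)"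

text \<open>The library asks for strong connectivity of the symmetric closure, with a reachability
  that is reflexive on the vertex set only. Symmetry of the arcs removes the first difference, and
  starting points in \<open>S\<close> remove the second.\<close>

lemma connected_induced_iff:
  fixes G :: "'a pair_pre_digraph"
  assumes "sym (parcs G)"
  shows "Digraph_Component.connected (with_proj G \<restriction> S) \<longleftrightarrow> connected_on (parcs G) S"
proof -
  let ?E = "parcs G \<inter> S \<times> S"
  have "arcs_ends (with_proj G \<restriction> S) = ?E"
    by (auto simp: arcs_ends_def arc_to_ends_def)
  moreover have "?E\<inverse> = ?E"
    using assms by (simp add: converse_Int converse_Times sym_conv_converse_eq)
  moreover have "arcs_ends (mk_symmetric H) = arcs_ends H \<union> (arcs_ends H)\<inverse>"
    for H :: "('a, 'a \<times> 'a) pre_digraph"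
    by (auto simp: parcs_mk_symmetric arcs_ends_conv)
  ultimately have *: "arcs_ends (mk_symmetric (with_proj G \<restriction> S)) = ?E"
    by simp
  have "(u, v) \<in> rtrancl_on S ?E \<longleftrightarrow> (u, v) \<in> ?E\<^sup>*" if "u \<in> S" for u v
  proof
    show "(u, v) \<in> ?E\<^sup>*" if "(u, v) \<in> rtrancl_on S ?E"
      using that by (induction rule: rtrancl_on_induct) (auto intro: rtrancl_into_rtrancl)
    show "(u, v) \<in> rtrancl_on S ?E" if "(u, v) \<in> ?E\<^sup>*"
      using that \<open>u \<in> S\<close>
      by (induction rule: rtrancl_induct) (auto intro: rtrancl_on_into_rtrancl_on)
  qed
  then show ?thesis
    unfolding Digraph_Component.connected_def strongly_connected_def connected_on_def
      reachable_def * by simp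
qed

text \<open>Walks are mapped to walks. The alternative \<open>h u = h v\<close> permits contracting
  an edge, as when a pendant vertex is folded onto its heavy neighbour.\<close>

lemma connected_on_image:
  assumes conn: "connected_on E S"
    and hom: "\<And>u v. u \<in> S \<Longrightarrow> v \<in> S \<Longrightarrow> (u, v) \<in> E \<Longrightarrow> h u = h v \<or> (h u, h v) \<in> E'"
  shows "connected_on E' (h ` S)"
proof -
  have "(h u, h v) \<in> (E' \<inter> h ` S \<times> h ` S)\<^sup>*" if "(u, v) \<in> (E \<inter> S \<times> S)\<^sup>*" for u v
    using that
  proof (induction rule: rtrancl_induct)
    case (step y z)
    then have "h y = h z \<or> (h y, h z) \<in> E' \<inter> h ` S \<times> h ` S"
      using hom[of y z] by auto
    with step.IH show ?case
      by (auto intro: rtrancl_into_rtrancl)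
  qed simp
  with conn show ?thesis
    by (auto simp: connected_on_def)
qed

text \<open>Everything is reachable from \<open>c\<close> and, by symmetry, reaches
  \<open>c\<close>; so any two vertices are joined through \<open>c\<close>.\<close>

lemma connected_on_insert_neighbours:
  assumes conn: "connected_on E S" and "sym E" and "c \<in> S" and "\<And>x. x \<in> X \<Longrightarrow> (c, x) \<in> E"
  shows "connected_on E (S \<union> X)"
proof -
  let ?R = "E \<inter> (S \<union> X) \<times> (S \<union> X)"
  have "(E \<inter> S \<times> S)\<^sup>* \<subseteq> ?R\<^sup>*"
    by (intro rtrancl_mono) auto
  then have "(c, v) \<in> ?R\<^sup>*" if "v \<in> S \<union> X" for v
    using that assms by (auto simp: connected_on_def)
  moreover have "sym (?R\<^sup>*)"
    using \<open>sym E\<close> by (intro sym_rtrancl) (auto simp: sym_def)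
  ultimately have "(u, v) \<in> ?R\<^sup>*" if "u \<in> S \<union> X" "v \<in> S \<union> X" for u v
    using that by (meson rtrancl_trans symD)
  with \<open>c \<in> S\<close> show ?thesis
    by (auto simp: connected_on_def)
qed

text \<open>Meant for pendant vertices: one that lies in a connected set without its only neighbour
  must be the whole set.\<close>

lemma connected_on_neighbour:
  assumes "connected_on E S" "u \<in> S" "v \<in> S" "u \<noteq> v"
  obtains w where "w \<in> S" "(u, w) \<in> E"
proof -
  have "(u, v) \<in> (E \<inter> S \<times> S)\<^sup>*"
    using assms by (auto simp: connected_on_def)
  with \<open>u \<noteq> v\<close> obtain w where "(u, w) \<in> E \<inter> S \<times> S"
    by (meson converse_rtranclE)
  then show thesis
    by (auto intro: that)
qed

section \<open>Connected vertex covers and the exchange of twins\<close>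

definition connected_vertex_cover :: "ngraph \<Rightarrow> nat set \<Rightarrow> bool" where
  "connected_vertex_cover G S \<longleftrightarrow> vertex_cover G S \<and> connected_on (parcs G) S"

lemma connected_vertex_cover_problem_iff:
  assumes "sym (parcs G)"
  shows "(G, k) \<in> connected_vertex_cover_problem \<longleftrightarrow>
     (\<exists>S. connected_vertex_cover G S \<and> card S \<le> k)"
  using connected_induced_iff[OF assms]
  by (auto simp: connected_vertex_cover_problem_def connected_vertex_cover_def)

text \<open>\<open>F\<close> is the part of the cover known in advance, so at most
  \<open>card (X - F)\<close> vertices have to be added while \<open>card C - 1\<close> are dropped;
  the \<open>+ 2\<close> makes the gain strict. The twin that stays is adjacent to all of
  \<open>X\<close> and thereby keeps the new cover connected.\<close>

lemma exchange_twins: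
  assumes fin: "finite (pverts G)" and arcs: "parcs G \<subseteq> pverts G \<times> pverts G"
    and sym: "sym (parcs G)" and irr: "irrefl (parcs G)"
    and T: "connected_vertex_cover G T" and "F \<subseteq> T"
    and C: "finite C" "\<And>c. c \<in> C \<Longrightarrow> nbhd G c = X"
    and large: "card (X - F) + 2 \<le> card C"
    and "\<not> X \<subseteq> T"
  shows "\<exists>T'. connected_vertex_cover G T' \<and> card T' < card T"
proof -
  have cover: "u \<in> T \<or> v \<in> T" if "(u, v) \<in> parcs G" for u v
    using T that by (auto simp: connected_vertex_cover_def vertex_cover_def)
  have TV: "T \<subseteq> pverts G" and conn: "connected_on (parcs G) T"
    using T by (auto simp: connected_vertex_cover_def vertex_cover_def)
  have finT: "finite T"
    using TV fin finite_subset by blast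
  from \<open>\<not> X \<subseteq> T\<close> obtain x where "x \<in> X" "x \<notin> T" by blast
  \<comment> \<open>The missing vertex \<open>x\<close> is a common neighbour of all twins, so
    covering its edges forces \<open>C\<close> into \<open>T\<close>.\<close>
  then have CT: "C \<subseteq> T"
    using cover C(2) unfolding nbhd_def by blast
  from large have "C \<noteq> {}" by auto
  then obtain c where "c \<in> C" by blast
  have XV: "X \<subseteq> pverts G"
    using C(2)[OF \<open>c \<in> C\<close>] arcs by (auto simp: nbhd_def)
  have finX: "finite X"
    using XV fin finite_subset by blast
  have twin: "(u, w) \<in> parcs G \<longleftrightarrow> w \<in> X" if "u \<in> C" for u w
    using C(2)[OF that] unfolding nbhd_def by blast
  have twin': "(w, u) \<in> parcs G \<longleftrightarrow> w \<in> X" if "u \<in> C" for u w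
    using twin[OF that] sym by (meson symD)
  have "X \<inter> C = {}"
    using twin irr by (auto simp: irrefl_def)
  \<comment> \<open>Twins have the same neighbours, so collapsing \<open>C\<close> onto
    \<open>c\<close> maps arcs to arcs, and dropping the other twins does not disconnect the
    cover.\<close>
  define r where "r v = (if v \<in> C then c else v)" for v
  have rT: "r ` T = insert c (T - C)"
    using CT \<open>c \<in> C\<close> by (auto simp: r_def)
  have "connected_on (parcs G) (r ` T)"
    by (rule connected_on_image[OF conn]) (use \<open>c \<in> C\<close> in \<open>auto simp: r_def twin twin'\<close>)
  then have "connected_on (parcs G) (r ` T \<union> X)"
    by (rule connected_on_insert_neighbours[OF _ sym, of _ c])
      (use \<open>c \<in> C\<close> rT twin in auto)
  moreover have "vertex_cover G (r ` T \<union> X)"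
  proof -
    have "u \<in> r ` T \<union> X \<or> v \<in> r ` T \<union> X" if "(u, v) \<in> parcs G" for u v
    proof (cases "u \<in> C \<or> v \<in> C")
      case True
      then show ?thesis
        using twin[of u v] twin'[of v u] that by blast
    next
      case False
      then show ?thesis
        using cover[OF that] rT by blast
    qed
    moreover have "r ` T \<union> X \<subseteq> pverts G"
      using subsetD[OF CT \<open>c \<in> C\<close>] TV XV unfolding rT by auto
    ultimately show ?thesis
      unfolding vertex_cover_def by blast
  qed
  moreover have "card (r ` T \<union> X) < card T"
  proof -
    have "r ` T \<union> X = insert c (T - C) \<union> (X - T)"
      using \<open>X \<inter> C = {}\<close> rT by auto
    then have "card (r ` T \<union> X) \<le> card (insert c (T - C)) + card (X - T)"
      by (simp only: card_Un_le)
    also have "card (insert c (T - C)) \<le> Suc (card T - card C)"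
      using finT by (simp add: card_insert_if card_Diff_subset[OF C(1) CT])
    also have "card (X - T) \<le> card (X - F)"
      using \<open>F \<subseteq> T\<close> finX by (intro card_mono) auto
    finally show ?thesis
      using large card_mono[OF finT CT] by linarith
  qed
  ultimately show ?thesis
    unfolding connected_vertex_cover_def by blast
qed

section \<open>Trimming classes of twins\<close>

lemma bij_betw_rank:
  fixes A :: "nat set"
  assumes "finite A"
  shows "bij_betw (\<lambda>v. card {u \<in> A. u < v}) A {0..<card A}"
proof -
  let ?r = "\<lambda>v. card {u \<in> A. u < v}"
  have less: "?r u < ?r v" if "u \<in> A" "u < v" for u v
    using assms that by (intro psubset_card_mono) auto
  have "inj_on ?r A"
    by (rule linorder_inj_onI') (use less less_imp_neq in blast)
  moreover have "?r ` A \<subseteq> {0..<card A}"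
    using assms by (auto intro!: psubset_card_mono)
  ultimately show ?thesis
    by (simp add: bij_betw_def card_image card_subset_eq)
qed

lemma card_rank_le:
  fixes A :: "nat set"
  assumes "finite A"
  shows "card {v \<in> A. card {u \<in> A. u < v} \<le> m} = min (card A) (Suc m)"
proof -
  let ?r = "\<lambda>v. card {u \<in> A. u < v}"
  have bij: "bij_betw ?r A {0..<card A}"
    using assms by (rule bij_betw_rank)
  have "?r ` {v \<in> A. ?r v \<le> m} = ?r ` A \<inter> {..m}"
    by auto
  also have "?r ` A = {0..<card A}"
    using bij by (rule bij_betw_imp_surj_on)
  also have "{0..<card A} \<inter> {..m} = {0..<min (card A) (Suc m)}"
    by auto
  finally have "?r ` {v \<in> A. ?r v \<le> m} = {0..<min (card A) (Suc m)}" .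
  moreover have "card (?r ` {v \<in> A. ?r v \<le> m}) = card {v \<in> A. ?r v \<le> m}"
    by (intro card_image inj_on_subset[OF bij_betw_imp_inj_on[OF bij]]) auto
  ultimately show ?thesis
    by simp
qed

definition heavy :: "ngraph \<Rightarrow> nat \<Rightarrow> nat set" where
  "heavy G k = {v \<in> pverts G. k < card (nbhd G v)}"

definition twins :: "ngraph \<Rightarrow> nat \<Rightarrow> nat set" where
  "twins G v = {u \<in> pverts G. nbhd G u = nbhd G v}"

definition twin_rank :: "ngraph \<Rightarrow> nat \<Rightarrow> nat" where
  "twin_rank G v = card {u \<in> twins G v. u < v}"

text \<open>Among light twins the smallest vertex numbers survive. Ranks start at 0, so admitting
  ranks up to \<open>x + 1\<close> retains \<open>x + 2\<close> vertices, where \<open>x\<close> is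
  \<open>card (nbhd G v - heavy G k)\<close>.\<close>

definition kept :: "ngraph \<Rightarrow> nat \<Rightarrow> nat set" where
  "kept G k = {v \<in> pverts G.
     v \<in> heavy G k \<or> twin_rank G v \<le> card (nbhd G v - heavy G k) + 1}"

text \<open>
  The vertex \<open>card (pverts G) + f\<close> is a pendant neighbour of the heavy vertex \<open>f\<close>.
\<close>

definition reduced :: "ngraph \<Rightarrow> nat \<Rightarrow> ngraph" where
  "reduced G k =
     (let n = card (pverts G); V = kept G k \<union> (+) n ` heavy G k
      in \<lparr>pverts = V, parcs = {(a, b) \<in> V \<times> V. (a, b) \<in> parcs G \<or> a = n + b \<or> b = n + a}\<rparr>)"

locale input_graph =
  fixes G :: ngraph and n :: nat
  assumes simple: "simple_graph G" and verts: "pverts G = {0..<n}"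
begin

lemma arcs: "parcs G \<subseteq> {0..<n} \<times> {0..<n}" and sym: "sym (parcs G)" and irrefl: "irrefl (parcs G)"
  using simple by (auto simp: simple_graph_iff verts)

lemma arc_less: "(u, v) \<in> parcs G \<Longrightarrow> u < n \<and> v < n"
  using arcs by auto

lemma arc_commute: "(u, v) \<in> parcs G \<longleftrightarrow> (v, u) \<in> parcs G"
  using sym by (auto dest: symD)

lemma no_loop: "(v, v) \<notin> parcs G"
  using irrefl by (simp add: irrefl_def)

lemma nbhd_iff: "v \<in> nbhd G u \<longleftrightarrow> (u, v) \<in> parcs G"
  by (simp add: nbhd_def)

lemma nbhd_subset: "nbhd G v \<subseteq> {0..<n}"
  using arcs by (auto simp: nbhd_iff)

lemma finite_nbhd [simp]: "finite (nbhd G v)"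
  using nbhd_subset finite_subset by blast

lemma finite_twins [simp]: "finite (twins G v)"
  by (simp add: twins_def verts)

lemma heavy_subset: "heavy G k \<subseteq> {0..<n}"
  by (auto simp: heavy_def verts)

lemma kept_subset: "kept G k \<subseteq> {0..<n}"
  by (auto simp: kept_def verts)

lemma heavy_subset_kept: "heavy G k \<subseteq> kept G k"
  by (auto simp: kept_def heavy_def)

lemma pverts_reduced: "pverts (reduced G k) = kept G k \<union> (+) n ` heavy G k"
  by (simp add: reduced_def verts Let_def)

lemma parcs_reduced:
  "(a, b) \<in> parcs (reduced G k) \<longleftrightarrow> a \<in> pverts (reduced G k) \<and> b \<in> pverts (reduced G k) \<and>
     ((a, b) \<in> parcs G \<or> a = n + b \<or> b = n + a)"
  by (simp add: reduced_def verts Let_def)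

lemma sym_reduced: "sym (parcs (reduced G k))"
  by (rule symI) (use arc_commute in \<open>auto simp: parcs_reduced\<close>)

lemma reduced_subset: "pverts (reduced G k) \<subseteq> {0..<2 * n}"
  using kept_subset heavy_subset by (fastforce simp: pverts_reduced)

lemma finite_reduced: "finite (pverts (reduced G k))"
  using reduced_subset finite_subset by blast

lemma irrefl_reduced: "irrefl (parcs (reduced G k))"
  using no_loop reduced_subset[of k] by (auto simp: irrefl_def parcs_reduced)

text \<open>A vertex outside a cover has its entire neighbourhood inside, hence at most
  \<open>k\<close> neighbours.\<close>

lemma heavy_subset_cover:
  assumes "connected_vertex_cover G T" "card T \<le> k"
  shows "heavy G k \<subseteq> T"
proof
  fix f
  assume f: "f \<in> heavy G k"
  show "f \<in> T"
  proof (rule ccontr)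
    assume "f \<notin> T"
    then have "nbhd G f \<subseteq> T"
      using assms(1) by (auto simp: nbhd_iff connected_vertex_cover_def vertex_cover_def)
    moreover have "finite T"
      using assms(1) finite_subset[of T "{0..<n}"]
      by (simp add: connected_vertex_cover_def vertex_cover_def verts)
    ultimately have "card (nbhd G f) \<le> k"
      using assms(2) card_mono[of T "nbhd G f"] by linarith
    with f show False
      by (simp add: heavy_def)
  qed
qed

text \<open>The least twin has rank 0 and passes every threshold, so each class retains a
  representative to which its removed members can be sent.\<close>

definition first_twin :: "nat \<Rightarrow> nat" where
  "first_twin v = (LEAST u. u \<in> twins G v)"

lemma nbhd_first_twin: "v < n \<Longrightarrow> nbhd G (first_twin v) = nbhd G v"
  and first_twin_kept: "v < n \<Longrightarrow> first_twin v \<in> kept G k"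
proof -
  assume "v < n"
  then have "v \<in> twins G v"
    by (simp add: twins_def verts)
  then have twin: "first_twin v \<in> twins G v"
    unfolding first_twin_def by (rule LeastI)
  then show *: "nbhd G (first_twin v) = nbhd G v"
    by (simp add: twins_def)
  have "{u \<in> twins G v. u < first_twin v} = {}"
    unfolding first_twin_def using not_less_Least by blast
  then have "twin_rank G (first_twin v) = 0"
    by (simp add: twin_rank_def twins_def *)
  with twin show "first_twin v \<in> kept G k"
    by (simp add: kept_def twins_def)
qed

text \<open>Sending removed members of the cover to their first twins preserves arcs and hence
  connectivity. Arcs of \<open>G\<close> between kept vertices stay covered because \<open>r\<close>
  fixes kept vertices; pendant arcs are covered by the heavy vertices.\<close>

lemma reduced_if:
  assumes T: "connected_vertex_cover G T" and k: "card T \<le> k"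
  shows "\<exists>S. connected_vertex_cover (reduced G k) S \<and> card S \<le> k"
proof -
  define r where "r v = (if v \<in> kept G k then v else first_twin v)" for v
  have TV: "T \<subseteq> {0..<n}" and conn: "connected_on (parcs G) T"
    and cover: "\<And>u v. (u, v) \<in> parcs G \<Longrightarrow> u \<in> T \<or> v \<in> T"
    using T by (auto simp: connected_vertex_cover_def vertex_cover_def verts)
  have r_kept: "r v \<in> kept G k" and nbhd_r: "nbhd G (r v) = nbhd G v" if "v < n" for v
    using that by (simp_all add: r_def first_twin_kept nbhd_first_twin)
  have rT: "T \<inter> kept G k \<subseteq> r ` T"
    by (auto simp: r_def)
  have hom: "(r u, r v) \<in> parcs (reduced G k)" if "(u, v) \<in> parcs G" for u v
  proof -
    have "u < n" "v < n"
      using arc_less[OF that] by auto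
    then have "(r u, r v) \<in> parcs G"
      using that nbhd_r[of u] nbhd_r[of v] by (metis arc_commute nbhd_iff)
    then show ?thesis
      using \<open>u < n\<close> \<open>v < n\<close> r_kept by (simp add: parcs_reduced pverts_reduced)
  qed
  have "connected_on (parcs (reduced G k)) (r ` T)"
    by (rule connected_on_image[OF conn]) (simp add: hom)
  moreover have "u \<in> r ` T \<or> v \<in> r ` T" if uv: "(u, v) \<in> parcs (reduced G k)" for u v
  proof (cases "(u, v) \<in> parcs G")
    case True
    then have "u \<in> kept G k" "v \<in> kept G k"
      using uv heavy_subset arc_less[OF True] by (auto simp: parcs_reduced pverts_reduced)
    with cover[OF True] rT show ?thesis by blast
  next
    case False
    then have "u \<in> heavy G k \<or> v \<in> heavy G k"
      using uv kept_subset[of k] heavy_subset[of k] by (fastforce simp: parcs_reduced pverts_reduced)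
    with heavy_subset_cover[OF T k] heavy_subset_kept rT show ?thesis by blast
  qed
  moreover have "r ` T \<subseteq> pverts (reduced G k)"
    using TV r_kept by (auto simp: pverts_reduced)
  ultimately have "connected_vertex_cover (reduced G k) (r ` T)"
    by (auto simp: connected_vertex_cover_def vertex_cover_def)
  moreover have "card (r ` T) \<le> k"
    using card_image_le[of T r] TV finite_subset k by fastforce
  ultimately show ?thesis by blast
qed

lemma twin_rank_less: "v < n \<Longrightarrow> twin_rank G v < card (twins G v)"
  unfolding twin_rank_def by (intro psubset_card_mono) (auto simp: twins_def verts)

lemma twins_not_heavy: "v \<notin> heavy G k \<Longrightarrow> v < n \<Longrightarrow> twins G v \<inter> heavy G k = {}"
  by (auto simp: twins_def heavy_def verts)

lemma nbhd_subset_kept: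
  assumes "v < n" "v \<notin> kept G k"
  shows "nbhd G v \<subseteq> kept G k"
proof
  fix u
  assume u: "u \<in> nbhd G v"
  \<comment> \<open>If \<open>u\<close> were removed as well, each of the two classes of twins would be larger than the other.\<close>
  have small: "card (twins G v) \<le> card (nbhd G u - heavy G k)"
    if "u \<in> nbhd G v" "v < n" "v \<notin> kept G k" for u v
  proof (intro card_mono)
    have "v \<notin> heavy G k"
      using that heavy_subset_kept by blast
    then show "twins G v \<subseteq> nbhd G u - heavy G k"
      using twins_not_heavy[of v k] that arc_commute by (auto simp: twins_def nbhd_iff)
  qed simp
  show "u \<in> kept G k"
  proof (rule ccontr)
    assume "u \<notin> kept G k"
    have "u < n" "v \<in> nbhd G u"
      using u arc_less arc_commute by (auto simp: nbhd_iff)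
    have late: "card (nbhd G w - heavy G k) + 1 < twin_rank G w" if "w < n" "w \<notin> kept G k" for w
      using that by (auto simp: kept_def verts)
    show False
      using small[OF u assms] small[OF \<open>v \<in> nbhd G u\<close> \<open>u < n\<close> \<open>u \<notin> kept G k\<close>]
        late[OF assms] late[OF \<open>u < n\<close> \<open>u \<notin> kept G k\<close>]
        twin_rank_less[OF \<open>u < n\<close>] twin_rank_less[OF \<open>v < n\<close>] by linarith
  qed
qed

text \<open>Without \<open>f\<close> the cover has to contain the pendant vertex
  \<open>n + f\<close>, whose only neighbour is missing, so connectivity leaves nothing else in it.
  But \<open>f\<close> still has a neighbour among the kept vertices, namely the first twin of any
  of its original neighbours, and that edge would be uncovered.\<close>

lemma heavy_subset_reduced_cover:
  assumes T: "connected_vertex_cover (reduced G k) T"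
  shows "heavy G k \<subseteq> T"
proof
  fix f
  assume f: "f \<in> heavy G k"
  have conn: "connected_on (parcs (reduced G k)) T"
    and cover: "\<And>u v. (u, v) \<in> parcs (reduced G k) \<Longrightarrow> u \<in> T \<or> v \<in> T"
    using T by (auto simp: connected_vertex_cover_def vertex_cover_def)
  have "f < n" "f \<in> kept G k"
    using f heavy_subset[of k] heavy_subset_kept[of k] by auto
  show "f \<in> T"
  proof (rule ccontr)
    assume "f \<notin> T"
    have "(f, n + f) \<in> parcs (reduced G k)"
      using f \<open>f \<in> kept G k\<close> by (simp add: parcs_reduced pverts_reduced)
    with \<open>f \<notin> T\<close> have "n + f \<in> T"
      using cover by blast
    have "T = {n + f}"
    proof (rule ccontr)
      assume "T \<noteq> {n + f}"
      then obtain v where "v \<in> T" "n + f \<noteq> v"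
        using \<open>n + f \<in> T\<close> by blast
      then obtain w where w: "w \<in> T" "(n + f, w) \<in> parcs (reduced G k)"
        using connected_on_neighbour[OF conn \<open>n + f \<in> T\<close>] by blast
      then have "w = f"
        using arc_less[of "n + f" w] reduced_subset[of k] by (fastforce simp: parcs_reduced)
      with \<open>w \<in> T\<close> \<open>f \<notin> T\<close> show False by simp
    qed
    have "nbhd G f \<noteq> {}"
      using f by (auto simp: heavy_def)
    then obtain w where w: "(f, w) \<in> parcs G"
      by (auto simp: nbhd_iff)
    then have "w < n"
      using arc_less by blast
    have "f \<in> nbhd G (first_twin w)"
      using w \<open>w < n\<close> arc_commute by (simp add: nbhd_first_twin nbhd_iff)
    then have "(f, first_twin w) \<in> parcs (reduced G k)"
      using first_twin_kept[OF \<open>w < n\<close>] \<open>f \<in> kept G k\<close> arc_commute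
      by (simp add: parcs_reduced pverts_reduced nbhd_iff)
    then have "first_twin w \<in> T"
      using cover \<open>f \<notin> T\<close> by blast
    then show False
      using \<open>T = {n + f}\<close> first_twin_kept[OF \<open>w < n\<close>] kept_subset by fastforce
  qed
qed

text \<open>A minimum cover admits no exchange, so it contains all neighbours of every removed
  vertex and thus covers the edges that were deleted with it.\<close>

lemma reduced_only_if:
  assumes T: "connected_vertex_cover (reduced G k) T" and k: "card T \<le> k"
    and minimal: "\<And>T'. connected_vertex_cover (reduced G k) T' \<Longrightarrow> card T \<le> card T'"
  shows "\<exists>S. connected_vertex_cover G S \<and> card S \<le> k"
proof -
  have TV: "T \<subseteq> pverts (reduced G k)" and conn: "connected_on (parcs (reduced G k)) T"
    and cover: "\<And>u v. (u, v) \<in> parcs (reduced G k) \<Longrightarrow> u \<in> T \<or> v \<in> T"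
    using T by (auto simp: connected_vertex_cover_def vertex_cover_def)
  have nbhd_T: "nbhd G v \<subseteq> T" if v: "v < n" "v \<notin> kept G k" for v
  proof (rule ccontr)
    assume "\<not> nbhd G v \<subseteq> T"
    define m where "m = card (nbhd G v - heavy G k) + 1"
    define C where "C = {u \<in> twins G v. card {w \<in> twins G v. w < u} \<le> m}"
    have "v \<notin> heavy G k"
      using v heavy_subset_kept by blast
    have "m < twin_rank G v"
      using v by (auto simp: kept_def verts m_def)
    \<comment> \<open>The rank of the removed vertex \<open>v\<close> exceeds \<open>m\<close>, so
      its class is large enough for the minimum in \<open>card_rank_le\<close> to be
      \<open>m + 1\<close>, which is the number that the exchange demands.\<close>
    then have "card C = m + 1"
      using twin_rank_less[OF \<open>v < n\<close>] by (simp add: C_def card_rank_le)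
    then have "card (nbhd G v - heavy G k) + 2 \<le> card C"
      by (simp add: m_def)
    \<comment> \<open>The retained twins lose no neighbour, since none of the neighbours of the
      removed \<open>v\<close> is removed, and they gain no pendant vertex, since they are not
      heavy.\<close>
    moreover have "nbhd (reduced G k) c = nbhd G v" if "c \<in> C" for c
    proof -
      have c: "nbhd G c = nbhd G v" "c < n" "c \<notin> heavy G k"
        using that twins_not_heavy[OF \<open>v \<notin> heavy G k\<close> \<open>v < n\<close>] by (auto simp: C_def twins_def verts)
      then have "twin_rank G c \<le> m"
        using that by (auto simp: C_def twin_rank_def twins_def)
      with c have "c \<in> kept G k"
        by (simp add: kept_def verts m_def)
      have "(c, w) \<in> parcs (reduced G k) \<longleftrightarrow> w \<in> nbhd G c" for w
      proof
        show "w \<in> nbhd G c" if "(c, w) \<in> parcs (reduced G k)"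
          using that c kept_subset[of k] by (fastforce simp: parcs_reduced pverts_reduced nbhd_iff)
        show "(c, w) \<in> parcs (reduced G k)" if "w \<in> nbhd G c"
          using that c \<open>c \<in> kept G k\<close> nbhd_subset_kept[OF v]
          by (auto simp: parcs_reduced pverts_reduced nbhd_iff)
      qed
      with c show ?thesis
        by (auto simp: nbhd_def)
    qed
    moreover have "parcs (reduced G k) \<subseteq> pverts (reduced G k) \<times> pverts (reduced G k)"
      by (auto simp: parcs_reduced)
    ultimately have "\<exists>T'. connected_vertex_cover (reduced G k) T' \<and> card T' < card T"
      using exchange_twins[OF finite_reduced _ sym_reduced irrefl_reduced T
          heavy_subset_reduced_cover[OF T], of C "nbhd G v"] \<open>\<not> nbhd G v \<subseteq> T\<close>
      by (simp add: C_def)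
    with minimal show False
      using not_less by blast
  qed
  \<comment> \<open>Folds each pendant vertex onto its heavy neighbour, contracting their edge, and
    fixes the vertices of \<open>G\<close>.\<close>
  define h where "h v = (if v < n then v else v - n)" for v
  have "connected_on (parcs G) (h ` T)"
  proof (rule connected_on_image[OF conn])
    fix u v
    assume "(u, v) \<in> parcs (reduced G k)"
    then show "h u = h v \<or> (h u, h v) \<in> parcs G"
      using arc_less[of u v] reduced_subset[of k] by (fastforce simp: parcs_reduced h_def)
  qed
  moreover have "h ` T \<subseteq> pverts G"
    using TV reduced_subset[of k] by (fastforce simp: h_def verts)
  moreover have "u \<in> h ` T \<or> v \<in> h ` T" if uv: "(u, v) \<in> parcs G" for u v
  proof -
    have *: "w \<in> h ` T" if "w \<in> T" "w < n" for w
      using that by (auto simp: h_def intro!: image_eqI[of w h w])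
    have "u \<in> T \<or> v \<in> T"
    proof (cases "u \<in> kept G k \<and> v \<in> kept G k")
      case True
      with uv show ?thesis
        by (intro cover) (simp add: parcs_reduced pverts_reduced)
    next
      case False
      with uv show ?thesis
        using nbhd_T[of u] nbhd_T[of v] arc_less[OF uv] arc_commute[of u v]
        unfolding nbhd_def by blast
    qed
    with * arc_less[OF uv] show ?thesis by blast
  qed
  ultimately have "connected_vertex_cover G (h ` T)"
    unfolding connected_vertex_cover_def vertex_cover_def by blast
  moreover have "card (h ` T) \<le> k"
    using card_image_le[of T h] TV finite_reduced finite_subset k by (meson order_trans)
  ultimately show ?thesis by blast
qed

theorem reduced_correct:
  "(reduced G k, k) \<in> connected_vertex_cover_problem \<longleftrightarrow>
     (G, k) \<in> connected_vertex_cover_problem"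
proof
  assume "(reduced G k, k) \<in> connected_vertex_cover_problem"
  then obtain S where "connected_vertex_cover (reduced G k) S" "card S \<le> k"
    by (auto simp: connected_vertex_cover_problem_iff[OF sym_reduced])
  moreover from this(1) obtain T where T: "connected_vertex_cover (reduced G k) T"
    "\<And>T'. connected_vertex_cover (reduced G k) T' \<Longrightarrow> card T \<le> card T'"
    using ex_has_least_nat[of "connected_vertex_cover (reduced G k)" S card] by blast
  ultimately have "card T \<le> k"
    by (meson order_trans)
  then show "(G, k) \<in> connected_vertex_cover_problem"
    using reduced_only_if[OF T(1) _ T(2)] by (simp add: connected_vertex_cover_problem_iff[OF sym])
qed (use reduced_if in \<open>auto simp: connected_vertex_cover_problem_iff sym sym_reduced\<close>)

end

section \<open>Invariance under isomorphism\<close>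

lemma connected_vertex_cover_iso:
  assumes bij: "bij_betw h (pverts G) (pverts H)"
    and arcs: "parcs H \<subseteq> pverts H \<times> pverts H"
    and iso: "\<And>u v. u \<in> pverts G \<Longrightarrow> v \<in> pverts G \<Longrightarrow>
      (u, v) \<in> parcs G \<longleftrightarrow> (h u, h v) \<in> parcs H"
    and S: "connected_vertex_cover G S"
  shows "connected_vertex_cover H (h ` S)"
proof -
  have SV: "S \<subseteq> pverts G"
    using S by (simp add: connected_vertex_cover_def vertex_cover_def)
  have "connected_on (parcs H) (h ` S)"
    by (rule connected_on_image[of "parcs G"])
      (use S SV iso in \<open>auto simp: connected_vertex_cover_def\<close>)
  moreover have "vertex_cover H (h ` S)"
    unfolding vertex_cover_def
  proof (intro conjI ballI, unfold split_paired_all case_prod_conv)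
    show "h ` S \<subseteq> pverts H"
      using SV bij by (auto simp: bij_betw_def)
    fix x y
    assume xy: "(x, y) \<in> parcs H"
    then have "x \<in> h ` pverts G" "y \<in> h ` pverts G"
      using arcs bij_betw_imp_surj_on[OF bij] by auto
    then obtain u v where "u \<in> pverts G" "v \<in> pverts G" "x = h u" "y = h v"
      by blast
    moreover from this have "u \<in> S \<or> v \<in> S"
      using xy iso[of u v] S by (auto simp: connected_vertex_cover_def vertex_cover_def)
    ultimately show "x \<in> h ` S \<or> y \<in> h ` S" by blast
  qed
  ultimately show ?thesis
    by (simp add: connected_vertex_cover_def)
qed

text \<open>Trimming leaves gaps in the vertex numbers, whereas an output graph must have an initial
  segment as its vertex set; this justifies the renumbering.\<close>

lemma connected_vertex_cover_problem_iso:
  assumes bij: "bij_betw h (pverts G) (pverts H)"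
    and arcs: "parcs G \<subseteq> pverts G \<times> pverts G" "parcs H \<subseteq> pverts H \<times> pverts H"
    and iso: "\<And>u v. u \<in> pverts G \<Longrightarrow> v \<in> pverts G \<Longrightarrow>
      (u, v) \<in> parcs G \<longleftrightarrow> (h u, h v) \<in> parcs H"
    and sym: "sym (parcs G)" "sym (parcs H)"
    and fin: "finite (pverts G)"
  shows "(G, k) \<in> connected_vertex_cover_problem \<longleftrightarrow> (H, k) \<in> connected_vertex_cover_problem"
proof -
  let ?h' = "inv_into (pverts G) h"
  have bij': "bij_betw ?h' (pverts H) (pverts G)"
    using bij by (rule bij_betw_inv_into)
  have iso': "(x, y) \<in> parcs H \<longleftrightarrow> (?h' x, ?h' y) \<in> parcs G"
    if xy: "x \<in> pverts H" "y \<in> pverts H" for x y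
  proof -
    have "?h' x \<in> pverts G" "?h' y \<in> pverts G"
      using bij' xy by (auto dest: bij_betwE)
    moreover have "h (?h' x) = x" "h (?h' y) = y"
      using xy by (auto intro: bij_betw_inv_into_right[OF bij])
    ultimately show ?thesis
      using iso[of "?h' x" "?h' y"] by simp
  qed
  have finH: "finite (pverts H)"
    using bij_betw_finite[OF bij] fin by simp
  have card: "card (g ` S) \<le> k"
    if "connected_vertex_cover K S" "finite (pverts K)" "card S \<le> k" for g and K :: ngraph and S
    using that card_image_le[of S g] finite_subset
    by (fastforce simp: connected_vertex_cover_def vertex_cover_def)
  show ?thesis
    unfolding connected_vertex_cover_problem_iff[OF sym(1)]
      connected_vertex_cover_problem_iff[OF sym(2)]
  proof
    assume "\<exists>S. connected_vertex_cover G S \<and> card S \<le> k"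
    then obtain S where S: "connected_vertex_cover G S" "card S \<le> k" by blast
    show "\<exists>S. connected_vertex_cover H S \<and> card S \<le> k"
      using connected_vertex_cover_iso[OF bij arcs(2) _ S(1)] iso card[OF S(1) fin S(2), of h]
      by (intro exI[of _ "h ` S"]) simp
  next
    assume "\<exists>S. connected_vertex_cover H S \<and> card S \<le> k"
    then obtain S where S: "connected_vertex_cover H S" "card S \<le> k" by blast
    show "\<exists>S. connected_vertex_cover G S \<and> card S \<le> k"
      using connected_vertex_cover_iso[OF bij' arcs(1) _ S(1)] iso' card[OF S(1) finH S(2), of ?h']
      by (intro exI[of _ "?h' ` S"]) simp
  qed
qed

section \<open>The size of the reduced graph\<close>

lemma power2_sum_le:
  fixes a b :: nat
  shows "(a + b)\<^sup>2 \<le> 2 * a\<^sup>2 + 2 * b\<^sup>2"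
proof -
  have "real ((a + b)\<^sup>2) \<le> real (2 * a\<^sup>2 + 2 * b\<^sup>2)"
    using sum_squares_bound[of "real a" "real b"] by (simp add: power2_sum)
  then show ?thesis
    by (simp only: of_nat_le_iff)
qed

context input_graph
begin

text \<open>Double counting of adjacent pairs: read from the side of \<open>T\<close>, there are at
  most \<open>k\<close> light vertices with at most \<open>k\<close> neighbours each.\<close>

lemma sum_nbhd_le:
  assumes T: "connected_vertex_cover G T" and k: "card T \<le> k"
  shows "(\<Sum>v\<in>{0..<n} - T. card (nbhd G v - heavy G k)) \<le> k\<^sup>2"
proof -
  have TV: "T \<subseteq> {0..<n}"
    using T by (auto simp: connected_vertex_cover_def vertex_cover_def verts)
  then have finT: "finite T"
    using finite_subset by blast
  have "(\<Sum>v\<in>{0..<n} - T. card (nbhd G v - heavy G k)) =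
      card (SIGMA v:{0..<n} - T. nbhd G v - heavy G k)"
    by simp
  also have "\<dots> \<le> card (prod.swap ` (SIGMA x:T - heavy G k. nbhd G x))"
  proof (rule card_mono)
    show "finite (prod.swap ` (SIGMA x:T - heavy G k. nbhd G x))"
      using finT by auto
    show "(SIGMA v:{0..<n} - T. nbhd G v - heavy G k) \<subseteq> prod.swap ` (SIGMA x:T - heavy G k. nbhd G x)"
    proof (rule subrelI)
      fix v x
      assume "(v, x) \<in> (SIGMA v:{0..<n} - T. nbhd G v - heavy G k)"
      then have "v \<notin> T" and x: "x \<in> nbhd G v" "x \<notin> heavy G k"
        by auto
      then have "x \<in> T"
        using T by (auto simp: connected_vertex_cover_def vertex_cover_def nbhd_iff)
      moreover have "v \<in> nbhd G x"
        using x arc_commute by (simp add: nbhd_iff)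
      ultimately show "(v, x) \<in> prod.swap ` (SIGMA x:T - heavy G k. nbhd G x)"
        using x by (intro image_eqI[of _ _ "(x, v)"]) auto
    qed
  qed
  also have "\<dots> = (\<Sum>x\<in>T - heavy G k. card (nbhd G x))"
    using finT by (subst card_image) auto
  also have "\<dots> \<le> (\<Sum>x\<in>T - heavy G k. k)"
    using TV by (intro sum_mono) (auto simp: heavy_def verts not_less)
  also have "\<dots> \<le> k * k"
    using card_mono[OF finT, of "T - heavy G k"] k by (auto intro!: mult_right_mono)
  finally show ?thesis
    by (simp add: power2_eq_square)
qed

text \<open>The cover, the pendant vertices and two additional twins per class contribute
  \<open>2 * (c + 1) * k\<close>; the rest is \<open>sum t \<X>\<close>, whose square is at most
  \<open>c * k ^ 3\<close>. The constant comes from squaring this sum of two terms by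
  \<open>power2_sum_le\<close>. In squared form the bound can be tested without extracting
  roots.\<close>

lemma card_reduced_le:
  assumes T: "connected_vertex_cover G T" and k: "card T \<le> k"
    and density: "\<And>X. X \<subseteq> pverts G \<Longrightarrow> X \<noteq> {} \<Longrightarrow>
      card {nbhd G v \<inter> X | v. v \<in> pverts G} \<le> c * card X"
  shows "(card (pverts (reduced G k)))\<^sup>2 \<le> (8 * (c + 1)\<^sup>2 + 2 * c) * k ^ 3"
proof -
  have TV: "T \<subseteq> {0..<n}" and "T \<noteq> {}" and cover: "\<And>u v. (u, v) \<in> parcs G \<Longrightarrow> u \<in> T \<or> v \<in> T"
    using T by (auto simp: connected_vertex_cover_def vertex_cover_def connected_on_def verts)
  have finT: "finite T"
    using TV finite_subset by blast
  with \<open>T \<noteq> {}\<close> have "0 < card T"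
    by (simp add: card_gt_0_iff)
  \<comment> \<open>Connected sets are nonempty, so the parameter is positive; this lets
    \<open>k ^ 2\<close> be absorbed into \<open>k ^ 3\<close>.\<close>
  with k have "1 \<le> k"
    by simp
  have heavyT: "heavy G k \<subseteq> T"
    using heavy_subset_cover[OF T k] .
  define I where "I = {0..<n} - T"
  define \<X> where "\<X> = nbhd G ` I"
  define B where "B X = {v \<in> I. nbhd G v = X}" for X
  define t where "t X = min (card (B X)) (card (X - heavy G k))" for X
  have finI: "finite I" and fin\<X>: "finite \<X>"
    by (auto simp: I_def \<X>_def)
  have "nbhd G v \<subseteq> T" if "v \<in> I" for v
    using cover that unfolding I_def nbhd_def by blast
  \<comment> \<open>Neighbourhoods of vertices outside \<open>T\<close> lie inside \<open>T\<close>,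
    so they are themselves traces on \<open>T\<close>, the sets that the density counts.\<close>
  then have "\<X> \<subseteq> {nbhd G v \<inter> T | v. v \<in> pverts G}"
    by (fastforce simp: \<X>_def I_def verts)
  moreover have "finite {nbhd G v \<inter> T | v. v \<in> pverts G}"
    by (simp add: verts)
  ultimately have "card \<X> \<le> card {nbhd G v \<inter> T | v. v \<in> pverts G}"
    by (simp add: card_mono)
  also have "\<dots> \<le> c * card T"
    using density TV \<open>T \<noteq> {}\<close> by (simp add: verts)
  finally have card\<X>: "card \<X> \<le> c * k"
    using k by (meson mult_le_mono2 order_trans)
  have "real ((sum t \<X>)\<^sup>2) \<le> real (card \<X> * (\<Sum>X\<in>\<X>. (t X)\<^sup>2))"
    using sum_squared_le_sum_of_squares[of "\<lambda>X. real (t X)" \<X>] by (simp add: mult.commute)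
  then have "(sum t \<X>)\<^sup>2 \<le> card \<X> * (\<Sum>X\<in>\<X>. (t X)\<^sup>2)"
    by (simp only: of_nat_le_iff)
  also have "(\<Sum>X\<in>\<X>. (t X)\<^sup>2) \<le> (\<Sum>X\<in>\<X>. \<Sum>v\<in>B X. card (nbhd G v - heavy G k))"
  proof (rule sum_mono)
    fix X
    \<comment> \<open>The square of a minimum of two numbers is at most their product, and it is the
      products that the double counting controls.\<close>
    have "(t X)\<^sup>2 \<le> card (B X) * card (X - heavy G k)"
      unfolding power2_eq_square by (intro mult_le_mono) (simp_all add: t_def)
    also have "\<dots> = (\<Sum>v\<in>B X. card (nbhd G v - heavy G k))"
      by (simp add: B_def)
    finally show "(t X)\<^sup>2 \<le> (\<Sum>v\<in>B X. card (nbhd G v - heavy G k))" .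
  qed
  also have "\<dots> = (\<Sum>v\<in>I. card (nbhd G v - heavy G k))"
    using sum.image_gen[OF finI, of "\<lambda>v. card (nbhd G v - heavy G k)" "nbhd G"]
    by (simp add: \<X>_def B_def)
  also have "\<dots> \<le> k\<^sup>2"
    unfolding I_def by (rule sum_nbhd_le[OF T k])
  finally have "(sum t \<X>)\<^sup>2 \<le> card \<X> * k\<^sup>2"
    by simp
  also have "\<dots> \<le> c * k * k\<^sup>2"
    using card\<X> by (rule mult_le_mono1)
  finally have sum_t: "(sum t \<X>)\<^sup>2 \<le> c * k ^ 3"
    by (simp add: power3_eq_cube power2_eq_square mult.assoc)
  have "card (kept G k \<inter> B X) \<le> t X + 2" for X
  proof -
    \<comment> \<open>Ranks refer to the whole class \<open>A\<close>, which may also meet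
      \<open>T\<close>. Trimming leaves at most \<open>card (X - heavy G k) + 2\<close> of its
      members, so no more than that outside \<open>T\<close>.\<close>
    define A where "A = {u \<in> {0..<n}. nbhd G u = X}"
    have "kept G k \<inter> B X \<subseteq> {v \<in> A. card {u \<in> A. u < v} \<le> card (X - heavy G k) + 1}"
    proof
      fix v
      assume v: "v \<in> kept G k \<inter> B X"
      then have "v \<notin> heavy G k" "v \<in> A" "A = twins G v"
        using heavyT by (auto simp: B_def I_def A_def twins_def verts)
      with v show "v \<in> {v \<in> A. card {u \<in> A. u < v} \<le> card (X - heavy G k) + 1}"
        by (auto simp: kept_def twin_rank_def B_def)
    qed
    then have "card (kept G k \<inter> B X) \<le>
        card {v \<in> A. card {u \<in> A. u < v} \<le> card (X - heavy G k) + 1}"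
      by (intro card_mono) (simp_all add: A_def)
    also have "\<dots> \<le> card (X - heavy G k) + 2"
      by (subst card_rank_le) (simp_all add: A_def)
    finally have "card (kept G k \<inter> B X) \<le> card (X - heavy G k) + 2" .
    moreover have "card (kept G k \<inter> B X) \<le> card (B X)"
      by (intro card_mono) (simp_all add: B_def finI)
    ultimately show ?thesis
      by (simp add: t_def)
  qed
  then have "(\<Sum>X\<in>\<X>. card (kept G k \<inter> B X)) \<le> (\<Sum>X\<in>\<X>. t X + 2)"
    by (rule sum_mono)
  also have "\<dots> = sum t \<X> + 2 * card \<X>"
    by (simp add: sum.distrib del: add_2_eq_Suc')
  finally have kept_B: "(\<Sum>X\<in>\<X>. card (kept G k \<inter> B X)) \<le> sum t \<X> + 2 * card \<X>" .
  have "kept G k \<subseteq> T \<union> (\<Union>X\<in>\<X>. kept G k \<inter> B X)"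
    using kept_subset[of k] unfolding \<X>_def B_def I_def by blast
  then have "card (kept G k) \<le> card (T \<union> (\<Union>X\<in>\<X>. kept G k \<inter> B X))"
    using finT fin\<X> finI by (intro card_mono) (auto simp: B_def)
  also have "\<dots> \<le> card T + (\<Sum>X\<in>\<X>. card (kept G k \<inter> B X))"
    by (intro order_trans[OF card_Un_le] add_left_mono card_UN_le fin\<X>)
  finally have card_kept: "card (kept G k) \<le> k + (sum t \<X> + 2 * (c * k))"
    using kept_B k card\<X> by linarith
  have "card (pverts (reduced G k)) \<le> card (kept G k) + card ((+) n ` heavy G k)"
    by (simp add: pverts_reduced card_Un_le)
  also have "card ((+) n ` heavy G k) \<le> k"
    using card_mono[OF finT heavyT] k by (simp add: card_image)
  finally have "card (pverts (reduced G k)) \<le> 2 * (c + 1) * k + sum t \<X>"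
    using card_kept by (simp add: algebra_simps)
  then have "(card (pverts (reduced G k)))\<^sup>2 \<le> (2 * (c + 1) * k + sum t \<X>)\<^sup>2"
    by (rule power_mono) simp
  also have "\<dots> \<le> 2 * (2 * (c + 1) * k)\<^sup>2 + 2 * (sum t \<X>)\<^sup>2"
    by (rule power2_sum_le)
  also have "\<dots> \<le> 8 * (c + 1)\<^sup>2 * k ^ 3 + 2 * (c * k ^ 3)"
  proof (rule add_mono)
    have "2 * (2 * (c + 1) * k)\<^sup>2 = 8 * (c + 1)\<^sup>2 * k\<^sup>2"
      by (simp only: power_mult_distrib mult.assoc) simp
    also have "\<dots> \<le> 8 * (c + 1)\<^sup>2 * k ^ 3"
      using power_increasing[OF _ \<open>1 \<le> k\<close>, of 2 3] by (intro mult_le_mono2) simp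
    finally show "2 * (2 * (c + 1) * k)\<^sup>2 \<le> 8 * (c + 1)\<^sup>2 * k ^ 3" .
  qed (use sum_t in simp)
  finally show ?thesis
    by (simp add: algebra_simps)
qed

end

section \<open>Tabulation on random access machines\<close>

text \<open>Truncated subtraction supplies all comparisons: \<open>a - b\<close> vanishes exactly
  when \<open>a\<close> is at most \<open>b\<close>.\<close>

definition ble :: "aexp \<Rightarrow> aexp \<Rightarrow> aexp" where
  "ble a b = Sub (Const 1) (Sub a b)"

definition bnot :: "aexp \<Rightarrow> aexp" where
  "bnot a = Sub (Const 1) a"

definition bor :: "aexp \<Rightarrow> aexp \<Rightarrow> aexp" where
  "bor a b = bnot (bnot (Add a b))"

definition band :: "aexp \<Rightarrow> aexp \<Rightarrow> aexp" where
  "band a b = bnot (Add (bnot a) (bnot b))"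

definition beq :: "aexp \<Rightarrow> aexp \<Rightarrow> aexp" where
  "beq a b = band (ble a b) (ble b a)"

text \<open>Multiplication by a constant, unrolled because the machine cannot multiply; the size of
  the expression depends on the constant only.\<close>

primrec scale :: "nat \<Rightarrow> aexp \<Rightarrow> aexp" where
  "scale 0 a = Const 0"
| "scale (Suc m) a = Add a (scale m a)"

lemma aval_bool_ops [simp]:
  "aval (ble a b) s = of_bool (aval a s \<le> aval b s)"
  "aval (bnot a) s = of_bool (aval a s = 0)"
  "aval (bor a b) s = of_bool (aval a s \<noteq> 0 \<or> aval b s \<noteq> 0)"
  "aval (band a b) s = of_bool (aval a s \<noteq> 0 \<and> aval b s \<noteq> 0)"
  "aval (beq a b) s = of_bool (aval a s = aval b s)"
  by (auto simp: ble_def bnot_def bor_def band_def beq_def)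

lemma aval_scale [simp]: "aval (scale m a) s = m * aval a s"
  by (induction m) simp_all

abbreviation scalar :: "nat \<Rightarrow> aexp" where
  "scalar b \<equiv> Cell b (Const 0)"

abbreviation (input) "row_index \<equiv> scalar 2"
abbreviation (input) "col_index \<equiv> scalar 3"

definition accumulate :: "nat \<Rightarrow> aexp \<Rightarrow> aexp \<Rightarrow> com" where
  "accumulate b l e =
     While (Sub l col_index)
       (Seq (Upd b row_index (Add (Cell b row_index) e))
         (Upd 3 (Const 0) (Add col_index (Const 1))))"

text \<open>
  For every \<open>i < m\<close> the cell \<open>i\<close> of bank \<open>b\<close> receives the sum of \<open>e\<close> over all \<open>j < l\<close>, where
  \<open>e\<close> finds \<open>i\<close> in bank 2 and \<open>j\<close> in bank 3.
\<close>

definition tabulate :: "nat \<Rightarrow> aexp \<Rightarrow> aexp \<Rightarrow> aexp \<Rightarrow> com" where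
  "tabulate b m l e =
     Seq (Upd 2 (Const 0) (Const 0))
       (While (Sub m row_index)
         (Seq (Seq (Upd b row_index (Const 0)) (Seq (Upd 3 (Const 0) (Const 0)) (accumulate b l e)))
           (Upd 2 (Const 0) (Add row_index (Const 1)))))"

text \<open>The loop alters only the banks 2, 3 and \<open>b\<close>, so \<open>l\<close> and
  \<open>e\<close> are required to have the right value in every store that agrees with
  \<open>s\<close> elsewhere. Each iteration costs three steps, one test and two assignments; the
  start column is left general for the induction on the remaining columns.\<close>

lemma accumulate_exec:
  fixes b :: nat
  assumes b: "b \<notin> {2, 3}" and "i = s 2 0"
    and l: "\<And>s'. (\<And>c. c \<notin> {2, 3, b} \<Longrightarrow> s' c = s c) \<Longrightarrow> aval l s' = L"
    and e: "\<And>s' j. (\<And>c. c \<notin> {2, 3, b} \<Longrightarrow> s' c = s c) \<Longrightarrow> s' 2 0 = i \<Longrightarrow> s' 3 0 = j \<Longrightarrow>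
      j < L \<Longrightarrow> aval e s' = f j"
  shows "\<exists>t s'. exec (accumulate b l e) s t s' \<and> t \<le> 3 * (L - s 3 0) + 1 \<and>
     s' 2 = s 2 \<and> s' b = (s b)(i := s b i + (\<Sum>j\<in>{s 3 0..<L}. f j)) \<and>
     (\<forall>c. c \<notin> {2, 3, b} \<longrightarrow> s' c = s c)"
  using \<open>i = s 2 0\<close> l e
proof (induction "L - s 3 0" arbitrary: s)
  case 0
  have "aval l s = L"
    by (rule "0.prems"(2)) simp
  with "0.hyps" have "exec (accumulate b l e) s 1 s"
    unfolding accumulate_def by (intro exec.WhileFalse) simp
  with "0.hyps" show ?case
    by (intro exI[of _ 1] exI[of _ s]) simp
next
  case (Suc d)
  have "aval l s = L"
    by (rule Suc.prems(2)) simp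
  have "s 3 0 < L"
    using Suc.hyps(2) by simp
  then have e: "aval e s = f (s 3 0)"
    using Suc.prems(1) by (intro Suc.prems(3)) auto
  define s1 where "s1 = s(b := (s b)(i := s b i + f (s 3 0)))"
  define s2 where "s2 = s1(3 := (s1 3)(0 := s 3 0 + 1))"
  have s2: "s2 2 = s 2" "s2 3 0 = s 3 0 + 1" "s2 b = (s b)(i := s b i + f (s 3 0))"
    "\<And>c. c \<notin> {2, 3, b} \<Longrightarrow> s2 c = s c"
    using b by (auto simp: s1_def s2_def)
  have "exec (Upd b row_index (Add (Cell b row_index) e)) s 1 s1"
    using exec.Upd[of b row_index "Add (Cell b row_index) e" s] Suc.prems(1)
    by (simp add: s1_def e)
  moreover have "exec (Upd 3 (Const 0) (Add col_index (Const 1))) s1 1 s2"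
    using exec.Upd[of 3 "Const 0" "Add col_index (Const 1)" s1] b
    by (simp add: s1_def s2_def)
  ultimately have body: "exec (Seq (Upd b row_index (Add (Cell b row_index) e))
      (Upd 3 (Const 0) (Add col_index (Const 1)))) s (1 + 1) s2"
    by (rule exec.Seq)
  have "\<exists>t s'. exec (accumulate b l e) s2 t s' \<and> t \<le> 3 * (L - s2 3 0) + 1 \<and>
     s' 2 = s2 2 \<and> s' b = (s2 b)(i := s2 b i + (\<Sum>j\<in>{s2 3 0..<L}. f j)) \<and>
     (\<forall>c. c \<notin> {2, 3, b} \<longrightarrow> s' c = s2 c)"
  proof (rule Suc.hyps(1))
    show "d = L - s2 3 0" "i = s2 2 0"
      using Suc.hyps(2) Suc.prems(1) s2 by simp_all
    show "aval l s' = L" if "\<And>c. c \<notin> {2, 3, b} \<Longrightarrow> s' c = s2 c" for s'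
      using that s2(4) by (intro Suc.prems(2)) simp
    show "aval e s' = f j" if "\<And>c. c \<notin> {2, 3, b} \<Longrightarrow> s' c = s2 c" "s' 2 0 = i" "s' 3 0 = j" "j < L"
      for s' j
      using that s2(4) by (intro Suc.prems(3)) simp_all
  qed
  then obtain t s' where t: "exec (accumulate b l e) s2 t s'" "t \<le> 3 * (L - s2 3 0) + 1"
    and s': "s' 2 = s2 2" "s' b = (s2 b)(i := s2 b i + (\<Sum>j\<in>{s2 3 0..<L}. f j))"
    "\<And>c. c \<notin> {2, 3, b} \<Longrightarrow> s' c = s2 c"
    by blast
  have "exec (accumulate b l e) s (1 + 1 + t + 1) s'"
    unfolding accumulate_def
    by (rule exec.WhileTrue[OF _ body t(1)[unfolded accumulate_def]])
      (use \<open>aval l s = L\<close> \<open>s 3 0 < L\<close> in simp)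
  moreover have "1 + 1 + t + 1 \<le> 3 * (L - s 3 0) + 1"
    using t(2) s2(2) \<open>s 3 0 < L\<close> by simp
  moreover have "s' b = (s b)(i := s b i + (\<Sum>j\<in>{s 3 0..<L}. f j))"
    using s'(2) s2 \<open>s 3 0 < L\<close> by (simp add: sum.atLeast_Suc_lessThan[of "s 3 0" L] add.assoc)
  ultimately show ?case
    using s'(1,3) s2 by (intro exI[of _ "1 + 1 + t + 1"] exI[of _ s']) simp
qed

text \<open>
  Banks 2 and 3 serve as scratch memory; a run is described by its effect on the other banks.
\<close>

definition runs :: "com \<Rightarrow> store \<Rightarrow> nat \<Rightarrow> store \<Rightarrow> bool" where
  "runs c \<Gamma> T \<Gamma>' \<longleftrightarrow> (\<forall>s. (\<forall>b. b \<notin> {2, 3} \<longrightarrow> s b = \<Gamma> b) \<longrightarrow>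
     (\<exists>t s'. exec c s t s' \<and> t \<le> T \<and> (\<forall>b. b \<notin> {2, 3} \<longrightarrow> s' b = \<Gamma>' b)))"

lemma runs_Seq:
  assumes "runs c1 \<Gamma> T1 \<Gamma>1" "runs c2 \<Gamma>1 T2 \<Gamma>2"
  shows "runs (Seq c1 c2) \<Gamma> (T1 + T2) \<Gamma>2"
  unfolding runs_def
proof (intro allI impI)
  fix s
  assume "\<forall>b. b \<notin> {2, 3} \<longrightarrow> s b = \<Gamma> b"
  then obtain t1 s1 where 1: "exec c1 s t1 s1" "t1 \<le> T1" "\<forall>b. b \<notin> {2, 3} \<longrightarrow> s1 b = \<Gamma>1 b"
    using assms(1) unfolding runs_def by meson
  then obtain t2 s2 where 2: "exec c2 s1 t2 s2" "t2 \<le> T2" "\<forall>b. b \<notin> {2, 3} \<longrightarrow> s2 b = \<Gamma>2 b"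
    using assms(2) unfolding runs_def by meson
  have "exec (Seq c1 c2) s (t1 + t2) s2"
    using 1(1) 2(1) by (rule exec.Seq)
  with 1(2) 2(2,3) show "\<exists>t s'. exec (Seq c1 c2) s t s' \<and> t \<le> T1 + T2 \<and>
      (\<forall>b. b \<notin> {2, 3} \<longrightarrow> s' b = \<Gamma>2 b)"
    by (intro exI[of _ "t1 + t2"] exI[of _ s2]) simp
qed

text \<open>A row costs at most \<open>3 * L + 5\<close> steps: the outer test, two resets, the
  inner loop with \<open>3 * L + 1\<close> and the increment. As the hypotheses leave bank
  \<open>b\<close> arbitrary, the expressions cannot depend on the table being filled.\<close>

lemma runs_tabulate:
  fixes b :: nat
  assumes b: "b \<notin> {2, 3}"
    and m: "\<And>s. (\<And>c. c \<notin> {2, 3, b} \<Longrightarrow> s c = \<Gamma> c) \<Longrightarrow> aval m s = M"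
    and l: "\<And>s. (\<And>c. c \<notin> {2, 3, b} \<Longrightarrow> s c = \<Gamma> c) \<Longrightarrow> aval l s = L"
    and e: "\<And>s i j. (\<And>c. c \<notin> {2, 3, b} \<Longrightarrow> s c = \<Gamma> c) \<Longrightarrow> s 2 0 = i \<Longrightarrow> s 3 0 = j \<Longrightarrow>
      i < M \<Longrightarrow> j < L \<Longrightarrow> aval e s = f i j"
  shows "runs (tabulate b m l e) \<Gamma> (5 * (M + 1) * (L + 1))
     (\<Gamma>(b := \<lambda>i. if i < M then \<Sum>j<L. f i j else \<Gamma> b i))"
proof -
  let ?body = "Seq (Seq (Upd b row_index (Const 0))
      (Seq (Upd 3 (Const 0) (Const 0)) (accumulate b l e)))
    (Upd 2 (Const 0) (Add row_index (Const 1)))"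
  let ?loop = "While (Sub m row_index) ?body"
  have loop: "\<exists>t s'. exec ?loop s t s' \<and> t \<le> (M - s 2 0) * (3 * L + 5) + 1 \<and>
      s' b = (\<lambda>i. if s 2 0 \<le> i \<and> i < M then \<Sum>j<L. f i j else s b i) \<and>
      (\<forall>c. c \<notin> {2, 3, b} \<longrightarrow> s' c = \<Gamma> c)"
    if "\<And>c. c \<notin> {2, 3, b} \<Longrightarrow> s c = \<Gamma> c" for s
    using that
  proof (induction "M - s 2 0" arbitrary: s)
    case 0
    have "exec ?loop s 1 s"
      by (rule exec.WhileFalse) (use "0.hyps" m[OF "0.prems"] in simp)
    with "0.hyps" "0.prems" show ?case
      by (intro exI[of _ 1] exI[of _ s]) auto
  next
    case (Suc d)
    define i where "i = s 2 0"
    have "i < M"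
      using Suc.hyps(2) by (simp add: i_def)
    define s1 where "s1 = s(b := (s b)(i := 0))"
    define s2 where "s2 = s1(3 := (s1 3)(0 := 0))"
    have s2: "s2 2 0 = i" "s2 3 0 = 0" "s2 b = (s b)(i := 0)" "\<And>c. c \<notin> {2, 3, b} \<Longrightarrow> s2 c = \<Gamma> c"
      using b Suc.prems by (auto simp: s1_def s2_def i_def)
    have 1: "exec (Upd b row_index (Const 0)) s 1 s1"
      using exec.Upd[of b row_index "Const 0" s] by (simp add: s1_def i_def)
    have 2: "exec (Upd 3 (Const 0) (Const 0)) s1 1 s2"
      using exec.Upd[of 3 "Const 0" "Const 0" s1] by (simp add: s2_def)
    have "\<exists>t s'. exec (accumulate b l e) s2 t s' \<and> t \<le> 3 * (L - s2 3 0) + 1 \<and>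
       s' 2 = s2 2 \<and> s' b = (s2 b)(i := s2 b i + (\<Sum>j\<in>{s2 3 0..<L}. f i j)) \<and>
       (\<forall>c. c \<notin> {2, 3, b} \<longrightarrow> s' c = s2 c)"
    proof (rule accumulate_exec[OF b])
      show "i = s2 2 0"
        by (simp add: s2(1))
      show "aval l s' = L" if "\<And>c. c \<notin> {2, 3, b} \<Longrightarrow> s' c = s2 c" for s'
        using that s2(4) by (intro l) simp
      show "aval e s' = f i j" if "\<And>c. c \<notin> {2, 3, b} \<Longrightarrow> s' c = s2 c" "s' 2 0 = i" "s' 3 0 = j" "j < L"
        for s' j
        using that s2(4) \<open>i < M\<close> by (intro e) simp_all
    qed
    then obtain t s3 where 3: "exec (accumulate b l e) s2 t s3" "t \<le> 3 * L + 1"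
      and s3: "s3 2 = s2 2" "s3 b = (s b)(i := \<Sum>j<L. f i j)" "\<And>c. c \<notin> {2, 3, b} \<Longrightarrow> s3 c = \<Gamma> c"
      using s2 by (auto simp: atLeast0LessThan)
    define s4 where "s4 = s3(2 := (s3 2)(0 := i + 1))"
    have s4: "s4 2 0 = i + 1" "s4 b = (s b)(i := \<Sum>j<L. f i j)" "\<And>c. c \<notin> {2, 3, b} \<Longrightarrow> s4 c = \<Gamma> c"
      using b s3 by (auto simp: s4_def)
    have 4: "exec (Upd 2 (Const 0) (Add row_index (Const 1))) s3 1 s4"
      using exec.Upd[of 2 "Const 0" "Add row_index (Const 1)" s3] s2(1) s3(1) by (simp add: s4_def)
    have body: "exec ?body s (1 + (1 + t) + 1) s4"
      by (intro exec.Seq[OF _ 4] exec.Seq[OF 1] exec.Seq[OF 2] 3(1))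
    have "d = M - s4 2 0"
      using Suc.hyps(2) s4(1) by (simp add: i_def)
    from Suc.hyps(1)[OF this s4(3)] obtain t' s5 where 5: "exec ?loop s4 t' s5"
      "t' \<le> (M - s4 2 0) * (3 * L + 5) + 1"
      "s5 b = (\<lambda>i. if s4 2 0 \<le> i \<and> i < M then \<Sum>j<L. f i j else s4 b i)"
      "\<forall>c. c \<notin> {2, 3, b} \<longrightarrow> s5 c = \<Gamma> c"
      by blast
    have "exec ?loop s (1 + (1 + t) + 1 + t' + 1) s5"
      by (rule exec.WhileTrue[OF _ body 5(1)])
        (use \<open>i < M\<close> m[OF Suc.prems] in \<open>simp add: i_def\<close>)
    moreover have "1 + (1 + t) + 1 + t' + 1 \<le> (M - s 2 0) * (3 * L + 5) + 1"
    proof -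
      have "M - s 2 0 = Suc (M - s4 2 0)"
        using \<open>i < M\<close> s4(1) by (simp add: i_def)
      then show ?thesis
        using 3(2) 5(2) by simp
    qed
    moreover have "s5 b = (\<lambda>i. if s 2 0 \<le> i \<and> i < M then \<Sum>j<L. f i j else s b i)"
      unfolding 5(3) s4(1,2) by (rule ext) (use \<open>i < M\<close> in \<open>auto simp: i_def\<close>)
    ultimately show ?case
      using 5(4) by blast
  qed
  show ?thesis
    unfolding runs_def
  proof (intro allI impI)
    fix s
    assume s: "\<forall>c. c \<notin> {2, 3} \<longrightarrow> s c = \<Gamma> c"
    define s1 where "s1 = s(2 := (s 2)(0 := 0))"
    have 1: "exec (Upd 2 (Const 0) (Const 0)) s 1 s1"
      using exec.Upd[of 2 "Const 0" "Const 0" s] by (simp add: s1_def)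
    have s1: "s1 2 0 = 0" "s1 b = \<Gamma> b" "\<And>c. c \<notin> {2, 3, b} \<Longrightarrow> s1 c = \<Gamma> c"
      using s b by (auto simp: s1_def)
    from loop[OF s1(3)] obtain t s' where 2: "exec ?loop s1 t s'" "t \<le> M * (3 * L + 5) + 1"
      "s' b = (\<lambda>i. if i < M then \<Sum>j<L. f i j else \<Gamma> b i)"
      "\<forall>c. c \<notin> {2, 3, b} \<longrightarrow> s' c = \<Gamma> c"
      unfolding s1(1,2) by auto
    have "exec (tabulate b m l e) s (1 + t) s'"
      unfolding tabulate_def by (rule exec.Seq[OF 1 2(1)])
    moreover have "1 + t \<le> 5 * (M + 1) * (L + 1)"
      using 2(2) by (simp add: algebra_simps)
    ultimately show "\<exists>t s'. exec (tabulate b m l e) s t s' \<and> t \<le> 5 * (M + 1) * (L + 1) \<and>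
        (\<forall>c. c \<notin> {2, 3} \<longrightarrow> s' c = (\<Gamma>(b := \<lambda>i. if i < M then \<Sum>j<L. f i j else \<Gamma> b i)) c)"
      using 2(3,4) by (intro exI[of _ "1 + t"] exI[of _ s']) auto
  qed
qed

section \<open>The program\<close>

definition table :: "nat \<Rightarrow> (nat \<Rightarrow> nat) \<Rightarrow> (nat \<Rightarrow> nat) \<Rightarrow> nat \<Rightarrow> nat" where
  "table M g h = (\<lambda>i. if i < M then g i else h i)"

lemma table_less [simp]: "i < M \<Longrightarrow> table M g h i = g i"
  by (simp add: table_def)

lemma runs_mono: "runs c \<Gamma> T \<Gamma>' \<Longrightarrow> T \<le> T' \<Longrightarrow> runs c \<Gamma> T' \<Gamma>'"
  unfolding runs_def by (meson order_trans)

text \<open>The form applied to every bank: the sum over the columns is replaced by its meaning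
  \<open>g\<close>, and a common bound \<open>z\<close> on the dimensions gives all tabulations the
  same cost, so that they only have to be counted.\<close>

lemma runs_table:
  fixes b :: nat
  assumes "\<Gamma>' = \<Gamma>(b := table M g h)" and "\<Gamma> b = h" and "b \<notin> {2, 3}"
    and "\<And>s. (\<And>c. c \<notin> {2, 3, b} \<Longrightarrow> s c = \<Gamma> c) \<Longrightarrow> aval m s = M"
    and "\<And>s. (\<And>c. c \<notin> {2, 3, b} \<Longrightarrow> s c = \<Gamma> c) \<Longrightarrow> aval l s = L"
    and "\<And>s i j. (\<And>c. c \<notin> {2, 3, b} \<Longrightarrow> s c = \<Gamma> c) \<Longrightarrow> s 2 0 = i \<Longrightarrow> s 3 0 = j \<Longrightarrow>
      i < M \<Longrightarrow> j < L \<Longrightarrow> aval e s = f i j"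
    and "\<And>i. i < M \<Longrightarrow> (\<Sum>j<L. f i j) = g i"
    and "M \<le> z" "L \<le> z"
  shows "runs (tabulate b m l e) \<Gamma> (5 * (z + 1)\<^sup>2) \<Gamma>'"
proof -
  have run: "runs (tabulate b m l e) \<Gamma> (5 * (M + 1) * (L + 1))
     (\<Gamma>(b := \<lambda>i. if i < M then \<Sum>j<L. f i j else \<Gamma> b i))"
    using assms(3-6) by (rule runs_tabulate)
  have "(\<lambda>i. if i < M then \<Sum>j<L. f i j else \<Gamma> b i) = table M g h"
    using assms(2,7) by (auto simp: table_def)
  moreover have "5 * (M + 1) * (L + 1) \<le> 5 * (z + 1)\<^sup>2"
    unfolding power2_eq_square mult.assoc using assms(8,9) by (intro mult_le_mono) simp_all
  ultimately show ?thesis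
    using run unfolding assms(1) by (auto intro: runs_mono)
qed

section \<open>Division and enumeration by counting\<close>

lemma sum_of_bool_less: "(\<Sum>j<(L::nat). of_bool (P j)) = card {j. j < L \<and> P j}"
proof -
  have "{..<L} \<inter> {j. P j} = {j. j < L \<and> P j}"
    by auto
  then show ?thesis
    by (simp add: sum_of_bool_eq)
qed

text \<open>Division without a division instruction: the quotient is the number of blocks of length
  \<open>m\<close> that end at or before \<open>p\<close>, which is a sum of truth values.\<close>

lemma card_multiples_le:
  fixes p :: nat
  assumes "p < n * m"
  shows "card {i. i < n \<and> i * m + m \<le> p} = p div m"
proof -
  have "0 < m"
    using assms by (cases m) auto
  then have "i * m + m \<le> p \<longleftrightarrow> i < p div m" for i
    using less_eq_div_iff_mult_less_eq[of m "Suc i" p] by (simp add: less_eq_Suc_le add.commute)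
  moreover have "i < p div m \<Longrightarrow> i < n" for i
    using less_mult_imp_div_less[OF assms] by (rule less_trans[rotated])
  ultimately have "{i. i < n \<and> i * m + m \<le> p} = {..<p div m}"
    by blast
  then show ?thesis by simp
qed

text \<open>For \<open>V\<close> below \<open>m\<close> and \<open>p < card V\<close> this is the
  \<open>p\<close>-th smallest element of \<open>V\<close>, counted from 0. Written as a count, it
  takes a single tabulation.\<close>

definition enumeration :: "nat \<Rightarrow> nat set \<Rightarrow> nat \<Rightarrow> nat" where
  "enumeration m V p = card {i. i < m \<and> card (V \<inter> {..i}) \<le> p}"

text \<open>It inverts the rank: the number of elements of \<open>V\<close> up to \<open>i\<close>
  stays within the rank of \<open>v\<close> as long as \<open>i < v\<close>, and \<open>v\<close>
  itself exceeds it. Surjectivity and equal cardinalities then give injectivity.\<close>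

lemma bij_betw_enumeration:
  assumes V: "V \<subseteq> {0..<m}"
  shows "bij_betw (enumeration m V) {0..<card V} V"
proof -
  let ?r = "\<lambda>v. card {u \<in> V. u < v}"
  have fin: "finite V"
    using V finite_subset by blast
  have left_inverse: "enumeration m V (?r v) = v" if "v \<in> V" for v
  proof -
    have "card (V \<inter> {..i}) \<le> ?r v \<longleftrightarrow> i < v" for i
    proof (cases "i < v")
      case True
      then have "card (V \<inter> {..i}) \<le> ?r v"
        using fin by (intro card_mono) auto
      with True show ?thesis by simp
    next
      case False
      then have "{u \<in> V. u < v} \<subseteq> V \<inter> {..i}" "v \<in> V \<inter> {..i}"
        using that by auto
      then have "{u \<in> V. u < v} \<subset> V \<inter> {..i}"
        by blast
      then have "?r v < card (V \<inter> {..i})"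
        using fin by (intro psubset_card_mono) auto
      with False show ?thesis by simp
    qed
    moreover have "i < v \<Longrightarrow> i < m" for i
      using V that by auto
    ultimately have "{i. i < m \<and> card (V \<inter> {..i}) \<le> ?r v} = {..<v}"
      by blast
    then show ?thesis
      by (simp add: enumeration_def)
  qed
  have r: "bij_betw ?r V {0..<card V}"
    using fin by (rule bij_betw_rank)
  then have r_image: "?r ` V = {0..<card V}"
    by (rule bij_betw_imp_surj_on)
  have "enumeration m V ` {0..<card V} = (\<lambda>v. enumeration m V (?r v)) ` V"
    by (simp only: r_image[symmetric] image_image)
  also have "\<dots> = V"
    using left_inverse by force
  finally have "enumeration m V ` {0..<card V} = V" .
  then show ?thesis
    by (simp add: bij_betw_def eq_card_imp_inj_on)
qed

abbreviation (input) "num_verts \<equiv> scalar 0"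
abbreviation (input) "param \<equiv> Cell 0 (Const 1)"

definition blt :: "aexp \<Rightarrow> aexp \<Rightarrow> aexp" where
  "blt a b = ble (Add a (Const 1)) b"

lemma aval_blt [simp]: "aval (blt a b) s = of_bool (aval a s < aval b s)"
  by (simp add: blt_def Suc_le_eq)

text \<open>The row offset is looked up in bank 4 because it cannot be computed by
  multiplication.\<close>

definition arc :: "aexp \<Rightarrow> aexp \<Rightarrow> aexp" where
  "arc a b = Cell 1 (Add (Cell 4 a) b)"

lemma aval_arc [simp]: "aval (arc a b) s = s 1 (s 4 (aval a s) + aval b s)"
  by (simp add: arc_def)

text \<open>
  Bank 4 holds the offsets of the rows of the adjacency matrix, bank 6 the first components of the
  pairs of vertices, bank 7 the number of vertices that distinguish the two components of a pair, and
  bank 10 the rank of a vertex among its twins.  Bank 11 marks the vertices of the reduced graph among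
  the numbers below \<open>2 * n\<close>; its \<open>p\<close>-th vertex (bank 14) is the number of prefixes with at most
  \<open>p\<close> marks.  Banks 15 and 17 serve to compare the squared number of marks with \<open>k ^ 3\<close>.
\<close>

definition analyse :: com where
  "analyse =
    (let i = row_index; j = col_index; n = num_verts; k = param in
     Seq (tabulate 4 n n i)
     (Seq (tabulate 5 (Const 1) n n)
     (Seq (tabulate 6 (scalar 5) n (ble (Add (Cell 4 j) n) i))
     (Seq (tabulate 7 (scalar 5) n
        (bnot (beq (arc (Cell 6 i) j) (arc (Sub i (Cell 4 (Cell 6 i))) j))))
     (Seq (tabulate 8 n n (arc i j))
     (Seq (tabulate 9 n n (band (arc i j) (ble (Cell 8 j) k)))
     (Seq (tabulate 10 n n (band (blt j i) (bnot (Cell 7 (Add (Cell 4 i) j)))))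
     (Seq (tabulate 11 (Add n n) (Const 1)
        (bor (band (blt i n)
            (bor (blt k (Cell 8 i)) (ble (Cell 10 i) (Add (Cell 9 i) (Const 1)))))
          (band (ble n i) (blt k (Cell 8 (Sub i n))))))
     (Seq (tabulate 12 (Add n n) (Add n n) (band (ble j i) (Cell 11 j)))
     (Seq (tabulate 13 (Const 1) (Add n n) (Cell 11 j))
     (Seq (tabulate 14 (scalar 13) (Add n n) (ble (Cell 12 j) i))
     (Seq (tabulate 15 (Const 1) (scalar 13) (scalar 13))
     (Seq (tabulate 16 (Const 1) k k)
       (tabulate 17 (Const 1) k (scalar 16)))))))))))))))"

text \<open>The new matrix is prepared in bank 20, since its entries are read from the old matrix in
  bank 1 at positions that might already be overwritten. The comparisons with \<open>n\<close> guard
  \<open>arc\<close>: a pendant vertex has no row there.\<close>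

definition build :: com where
  "build =
    (let i = row_index; j = col_index; n = num_verts; m = scalar 13;
       a = Cell 14 (Cell 19 i); b = Cell 14 (Sub i (Cell 18 (Cell 19 i))) in
     Seq (tabulate 18 m m i)
     (Seq (tabulate 19 (scalar 15) m (ble (Add (Cell 18 j) m) i))
     (Seq (tabulate 20 (scalar 15) (Const 1)
        (bor (band (band (blt a n) (blt b n)) (arc a b))
          (bor (beq a (Add n b)) (beq b (Add n a)))))
       (tabulate 1 (scalar 15) (Const 1) (Cell 20 i)))))"

context input_graph
begin

lemma input_store:
  "input_store G k 0 0 = n" "input_store G k 0 (Suc 0) = k"
  "i < n \<Longrightarrow> j < n \<Longrightarrow> input_store G k (Suc 0) (i * n + j) = of_bool ((i, j) \<in> parcs G)"
proof -
  show "input_store G k 0 0 = n" "input_store G k 0 (Suc 0) = k"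
    by (simp_all add: input_store_def verts)
  assume "i < n" "j < n"
  then have "i * n + j < n * n"
    using mult_le_mono1[of "Suc i" n n] by simp
  with \<open>j < n\<close> show "input_store G k (Suc 0) (i * n + j) = of_bool ((i, j) \<in> parcs G)"
    by (simp add: input_store_def verts)
qed

lemma card_reduced_le_double: "card (pverts (reduced G k)) \<le> 2 * n"
  using card_mono[OF _ reduced_subset, of k] by simp

lemma slot_iff:
  "i \<in> pverts (reduced G k) \<longleftrightarrow>
     i < n \<and> (k < card (nbhd G i) \<or> twin_rank G i \<le> card (nbhd G i - heavy G k) + 1) \<or>
     n \<le> i \<and> i < 2 * n \<and> k < card (nbhd G (i - n))"
proof -
  have "i \<in> (+) n ` heavy G k \<longleftrightarrow> n \<le> i \<and> i < 2 * n \<and> k < card (nbhd G (i - n))"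
  proof
    assume "n \<le> i \<and> i < 2 * n \<and> k < card (nbhd G (i - n))"
    then show "i \<in> (+) n ` heavy G k"
      by (intro image_eqI[of _ _ "i - n"]) (auto simp: heavy_def verts)
  qed (auto simp: heavy_def verts)
  then show ?thesis
    by (auto simp: pverts_reduced kept_def heavy_def verts)
qed

text \<open>The cube of \<open>k\<close> is computed by loops of length \<open>k\<close>, although
  \<open>k\<close> enters the instance size in binary only. The assumption \<open>k < n\<close>
  keeps these loops polynomial.\<close>

lemma run_analyse:
  assumes "k < n"
  defines "V \<equiv> pverts (reduced G k)"
  shows "\<exists>\<Gamma>. runs analyse (input_store G k) (70 * (4 * (n * n) + 1)\<^sup>2) \<Gamma> \<and>
    \<Gamma> 0 = input_store G k 0 \<and> \<Gamma> 1 = input_store G k 1 \<and>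
    (\<forall>i<n. \<Gamma> 4 i = i * n) \<and>
    \<Gamma> 13 0 = card V \<and> (\<forall>p<card V. \<Gamma> 14 p = enumeration (2 * n) V p) \<and>
    \<Gamma> 15 0 = card V * card V \<and> \<Gamma> 17 0 = k * (k * k)"
proof -
  \<comment> \<open>One bound for the dimensions of all tables, also of those in
    \<open>build\<close>, where the square of \<open>card V\<close> occurs and \<open>card V\<close>
    is at most \<open>2 * n\<close>. Fourteen tabulations with factor 5 each give the factor
    70.\<close>
  define z where "z = 4 * (n * n)"
  have "0 < n"
    using assms(1) by simp
  then have "n \<le> n * n"
    by simp
  with assms(1) have z: "Suc 0 \<le> z" "n \<le> z" "2 * n \<le> z" "n * n \<le> z" "k \<le> z"
    unfolding z_def by linarith+
  have V: "card V \<le> 2 * n"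
    unfolding V_def by (rule card_reduced_le_double)
  then have zV: "card V \<le> z" "card V * card V \<le> z"
    using order_trans[OF V z(3)] mult_le_mono[OF V V] by (simp_all add: z_def)
  define \<Gamma>0 where "\<Gamma>0 = input_store G k"
  define \<Gamma>1 where "\<Gamma>1 = \<Gamma>0(4 := table n (\<lambda>i. i * n) (\<Gamma>0 4))"
  define \<Gamma>2 where "\<Gamma>2 = \<Gamma>1(5 := table 1 (\<lambda>_. n * n) (\<Gamma>0 5))"
  define \<Gamma>3 where "\<Gamma>3 = \<Gamma>2(6 := table (n * n) (\<lambda>p. p div n) (\<Gamma>0 6))"
  define d :: "nat \<Rightarrow> nat"
    where "d p = (\<Sum>u<n. of_bool (((p div n, u) \<in> parcs G) \<noteq> ((p mod n, u) \<in> parcs G)))"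
    for p
  define \<Gamma>4 where "\<Gamma>4 = \<Gamma>3(7 := table (n * n) d (\<Gamma>0 7))"
  define \<Gamma>5 where "\<Gamma>5 = \<Gamma>4(8 := table n (\<lambda>i. card (nbhd G i)) (\<Gamma>0 8))"
  define \<Gamma>6 where "\<Gamma>6 = \<Gamma>5(9 := table n (\<lambda>i. card (nbhd G i - heavy G k)) (\<Gamma>0 9))"
  define \<Gamma>7 where "\<Gamma>7 = \<Gamma>6(10 := table n (twin_rank G) (\<Gamma>0 10))"
  define \<Gamma>8 where "\<Gamma>8 = \<Gamma>7(11 := table (2 * n) (\<lambda>i. of_bool (i \<in> V)) (\<Gamma>0 11))"
  define \<Gamma>9 where "\<Gamma>9 = \<Gamma>8(12 := table (2 * n) (\<lambda>i. card (V \<inter> {..i})) (\<Gamma>0 12))"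
  define \<Gamma>10 where "\<Gamma>10 = \<Gamma>9(13 := table 1 (\<lambda>_. card V) (\<Gamma>0 13))"
  define \<Gamma>11 where "\<Gamma>11 = \<Gamma>10(14 := table (card V) (enumeration (2 * n) V) (\<Gamma>0 14))"
  define \<Gamma>12 where "\<Gamma>12 = \<Gamma>11(15 := table 1 (\<lambda>_. card V * card V) (\<Gamma>0 15))"
  define \<Gamma>13 where "\<Gamma>13 = \<Gamma>12(16 := table 1 (\<lambda>_. k * k) (\<Gamma>0 16))"
  define \<Gamma>14 where "\<Gamma>14 = \<Gamma>13(17 := table 1 (\<lambda>_. k * (k * k)) (\<Gamma>0 17))"
  note \<Gamma>_defs = \<Gamma>1_def \<Gamma>2_def \<Gamma>3_def \<Gamma>4_def \<Gamma>5_def \<Gamma>6_def \<Gamma>7_def \<Gamma>8_def \<Gamma>9_def \<Gamma>10_def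
    \<Gamma>11_def \<Gamma>12_def \<Gamma>13_def \<Gamma>14_def
  have \<Gamma>0: "\<Gamma>0 0 0 = n" "\<Gamma>0 0 (Suc 0) = k"
    "\<And>i j. i < n \<Longrightarrow> j < n \<Longrightarrow> \<Gamma>0 (Suc 0) (i * n + j) = of_bool ((i, j) \<in> parcs G)"
    unfolding \<Gamma>0_def by (fact input_store)+
  have div: "p div n < n" "p - p div n * n = p mod n" "p mod n < n" if "p < n * n" for p
    using that \<open>0 < n\<close> by (simp_all add: less_mult_imp_div_less minus_div_mult_eq_mod)
  have 1: "runs (tabulate 4 num_verts num_verts row_index) \<Gamma>0 (5 * (z + 1)\<^sup>2) \<Gamma>1"
    by (rule runs_table[where f = "\<lambda>i j. i" and L = n, OF \<Gamma>1_def])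
      (use z in \<open>simp_all add: \<Gamma>_defs \<Gamma>0\<close>)
  have 2: "runs (tabulate 5 (Const 1) num_verts num_verts) \<Gamma>1 (5 * (z + 1)\<^sup>2) \<Gamma>2"
    by (rule runs_table[where f = "\<lambda>i j. n" and L = n, OF \<Gamma>2_def])
      (use z in \<open>simp_all add: \<Gamma>_defs \<Gamma>0\<close>)
  have 3: "runs (tabulate 6 (scalar 5) num_verts (ble (Add (Cell 4 col_index) num_verts) row_index))
      \<Gamma>2 (5 * (z + 1)\<^sup>2) \<Gamma>3"
    by (rule runs_table[where f = "\<lambda>i j. of_bool (j * n + n \<le> i)" and L = n, OF \<Gamma>3_def])
      (use z in \<open>simp_all add: \<Gamma>_defs \<Gamma>0 sum_of_bool_less card_multiples_le\<close>)
  have 4: "runs (tabulate 7 (scalar 5) num_verts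
        (bnot (beq (arc (Cell 6 row_index) col_index)
          (arc (Sub row_index (Cell 4 (Cell 6 row_index))) col_index))))
      \<Gamma>3 (5 * (z + 1)\<^sup>2) \<Gamma>4"
    by (rule runs_table[where
          f = "\<lambda>p u. of_bool (((p div n, u) \<in> parcs G) \<noteq> ((p mod n, u) \<in> parcs G))"
          and L = n,
          OF \<Gamma>4_def])
      (use z div in \<open>simp_all add: \<Gamma>_defs \<Gamma>0 d_def\<close>)
  have nbhd: "{j. j < n \<and> (i, j) \<in> parcs G} = nbhd G i" for i
    by (auto simp: nbhd_iff dest: arc_less)
  have 5: "runs (tabulate 8 num_verts num_verts (arc row_index col_index)) \<Gamma>4 (5 * (z + 1)\<^sup>2) \<Gamma>5"
    by (rule runs_table[where f = "\<lambda>i j. of_bool ((i, j) \<in> parcs G)" and L = n, OF \<Gamma>5_def])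
      (use z in \<open>simp_all add: \<Gamma>_defs \<Gamma>0 sum_of_bool_less nbhd\<close>)
  have light: "{j. j < n \<and> (i, j) \<in> parcs G \<and> card (nbhd G j) \<le> k} = nbhd G i - heavy G k" for i
    by (auto simp: nbhd_iff heavy_def verts dest: arc_less)
  have 6: "runs (tabulate 9 num_verts num_verts
        (band (arc row_index col_index) (ble (Cell 8 col_index) param)))
      \<Gamma>5 (5 * (z + 1)\<^sup>2) \<Gamma>6"
    by (rule runs_table[where f = "\<lambda>i j. of_bool ((i, j) \<in> parcs G \<and> card (nbhd G j) \<le> k)"
          and L = n, OF \<Gamma>6_def])
      (use z in \<open>simp_all add: \<Gamma>_defs \<Gamma>0 sum_of_bool_less light\<close>)
  \<comment> \<open>Equality of neighbourhoods is a universal statement; the tabulation expresses it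
    by a vanishing number of distinguishing vertices.\<close>
  have d0: "d (i * n + j) = 0 \<longleftrightarrow> nbhd G j = nbhd G i" if "i < n" "j < n" for i j
  proof -
    have "d (i * n + j) = 0 \<longleftrightarrow> (\<forall>u<n. (i, u) \<in> parcs G \<longleftrightarrow> (j, u) \<in> parcs G)"
      using that by (auto simp: d_def)
    also have "\<dots> \<longleftrightarrow> nbhd G j = nbhd G i"
      using arc_less by (auto simp: nbhd_def set_eq_iff)
    finally show ?thesis .
  qed
  have rank: "card {j. j < n \<and> j < i \<and> nbhd G j = nbhd G i} = twin_rank G i" for i
    unfolding twin_rank_def by (rule arg_cong[where f = card]) (auto simp: twins_def verts)
  have index: "i * n + j < n * n" if "i < n" "j < n" for i j
    using that mult_le_mono1[of "Suc i" n n] by simp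
  have 7: "runs (tabulate 10 num_verts num_verts
        (band (blt col_index row_index) (bnot (Cell 7 (Add (Cell 4 row_index) col_index)))))
      \<Gamma>6 (5 * (z + 1)\<^sup>2) \<Gamma>7"
    by (rule runs_table[where f = "\<lambda>i j. of_bool (j < i \<and> nbhd G j = nbhd G i)" and L = n, OF \<Gamma>7_def])
      (use z in \<open>simp_all add: \<Gamma>_defs \<Gamma>0 sum_of_bool_less index d0 rank\<close>)
  have V_iff: "i \<in> V \<longleftrightarrow>
     i < n \<and> (k < card (nbhd G i) \<or> twin_rank G i \<le> Suc (card (nbhd G i - heavy G k))) \<or>
     n \<le> i \<and> k < card (nbhd G (i - n))" if "i < 2 * n" for i
    using that by (auto simp: V_def slot_iff)
  have 8: "runs (tabulate 11 (Add num_verts num_verts) (Const 1)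
        (bor (band (blt row_index num_verts)
            (bor (blt param (Cell 8 row_index))
              (ble (Cell 10 row_index) (Add (Cell 9 row_index) (Const 1)))))
          (band (ble num_verts row_index) (blt param (Cell 8 (Sub row_index num_verts))))))
      \<Gamma>7 (5 * (z + 1)\<^sup>2) \<Gamma>8"
  proof (rule runs_table[where f = "\<lambda>i j. of_bool (i \<in> V)" and L = 1, OF \<Gamma>8_def])
    fix s i j
    assume s: "\<And>c. c \<notin> {2, 3, 11} \<Longrightarrow> s c = \<Gamma>7 c" "s 2 0 = i" "s 3 0 = j" and "i < 2 * n"
    then show "aval (bor (band (blt row_index num_verts)
            (bor (blt param (Cell 8 row_index))
              (ble (Cell 10 row_index) (Add (Cell 9 row_index) (Const 1)))))
          (band (ble num_verts row_index) (blt param (Cell 8 (Sub row_index num_verts))))) s =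
        of_bool (i \<in> V)"
      by (cases "i < n") (simp_all add: \<Gamma>_defs \<Gamma>0 V_iff)
  qed (use z in \<open>simp_all add: \<Gamma>_defs \<Gamma>0\<close>)
  have below: "{j. j < 2 * n \<and> P j \<and> j \<in> V} = V \<inter> {j. P j}" for P
    using reduced_subset[of k] by (auto simp: V_def)
  have 9: "runs (tabulate 12 (Add num_verts num_verts) (Add num_verts num_verts)
        (band (ble col_index row_index) (Cell 11 col_index))) \<Gamma>8 (5 * (z + 1)\<^sup>2) \<Gamma>9"
    by (rule runs_table[where f = "\<lambda>i j. of_bool (j \<le> i \<and> j \<in> V)" and L = "2 * n", OF \<Gamma>9_def])
      (use z in \<open>simp_all add: \<Gamma>_defs \<Gamma>0 sum_of_bool_less below atMost_def\<close>)
  have 10: "runs (tabulate 13 (Const 1) (Add num_verts num_verts) (Cell 11 col_index))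
      \<Gamma>9 (5 * (z + 1)\<^sup>2) \<Gamma>10"
    by (rule runs_table[where f = "\<lambda>i j. of_bool (j \<in> V)" and L = "2 * n", OF \<Gamma>10_def])
      (use z below[of "\<lambda>_. True"] in \<open>simp_all add: \<Gamma>_defs \<Gamma>0 sum_of_bool_less\<close>)
  have 11: "runs (tabulate 14 (scalar 13) (Add num_verts num_verts)
        (ble (Cell 12 col_index) row_index))
      \<Gamma>10 (5 * (z + 1)\<^sup>2) \<Gamma>11"
    by (rule runs_table[where f = "\<lambda>p j. of_bool (card (V \<inter> {..j}) \<le> p)" and L = "2 * n", OF \<Gamma>11_def])
      (use z zV in \<open>simp_all add: \<Gamma>_defs \<Gamma>0 sum_of_bool_less enumeration_def\<close>)
  have 12: "runs (tabulate 15 (Const 1) (scalar 13) (scalar 13)) \<Gamma>11 (5 * (z + 1)\<^sup>2) \<Gamma>12"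
    by (rule runs_table[where f = "\<lambda>i j. card V" and L = "card V", OF \<Gamma>12_def])
      (use z zV in \<open>simp_all add: \<Gamma>_defs \<Gamma>0\<close>)
  have 13: "runs (tabulate 16 (Const 1) param param) \<Gamma>12 (5 * (z + 1)\<^sup>2) \<Gamma>13"
    by (rule runs_table[where f = "\<lambda>i j. k" and L = k, OF \<Gamma>13_def])
      (use z in \<open>simp_all add: \<Gamma>_defs \<Gamma>0\<close>)
  have 14: "runs (tabulate 17 (Const 1) param (scalar 16)) \<Gamma>13 (5 * (z + 1)\<^sup>2) \<Gamma>14"
    by (rule runs_table[where f = "\<lambda>i j. k * k" and L = k, OF \<Gamma>14_def])
      (use z in \<open>simp_all add: \<Gamma>_defs \<Gamma>0\<close>)
  have "runs analyse \<Gamma>0 (70 * (z + 1)\<^sup>2) \<Gamma>14"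
    unfolding analyse_def Let_def
    by (rule runs_mono[OF runs_Seq[OF 1 runs_Seq[OF 2 runs_Seq[OF 3 runs_Seq[OF 4 runs_Seq[OF 5
      runs_Seq[OF 6 runs_Seq[OF 7 runs_Seq[OF 8 runs_Seq[OF 9 runs_Seq[OF 10 runs_Seq[OF 11
      runs_Seq[OF 12 runs_Seq[OF 13 14]]]]]]]]]]]]]]) simp
  moreover have "\<Gamma>14 0 = \<Gamma>0 0" "\<Gamma>14 1 = \<Gamma>0 1" "\<forall>i<n. \<Gamma>14 4 i = i * n"
    "\<Gamma>14 13 0 = card V" "\<forall>p<card V. \<Gamma>14 14 p = enumeration (2 * n) V p"
    "\<Gamma>14 15 0 = card V * card V" "\<Gamma>14 17 0 = k * (k * k)"
    by (simp_all add: \<Gamma>_defs)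
  ultimately show ?thesis
    unfolding \<Gamma>0_def z_def by blast
qed

end

section \<open>Renumbering and the complete kernel\<close>

definition compacted :: "ngraph \<Rightarrow> nat \<Rightarrow> ngraph" where
  "compacted G k =
     (let V = pverts (reduced G k); h = enumeration (2 * card (pverts G)) V
      in \<lparr>pverts = {0..<card V},
          parcs = {(i, j) \<in> {0..<card V} \<times> {0..<card V}. (h i, h j) \<in> parcs (reduced G k)}\<rparr>)"

text \<open>The outer test returns instances with at most \<open>k\<close> vertices unchanged and
  guarantees \<open>k < n\<close> for the analysis. The rejecting branch outputs the empty graph
  with parameter 0, a negative instance because connected sets are nonempty.\<close>

definition kernel :: "nat \<Rightarrow> com" where
  "kernel D =
     Cond (Sub num_verts param)
       (Seq analyse
         (Cond (ble (scalar 15) (scale D (scalar 17)))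
           (Seq build (Upd 0 (Const 0) (scalar 13)))
           (Seq (Upd 0 (Const 0) (Const 0)) (Upd 0 (Const 1) (Const 0)))))
       Skip"

context input_graph
begin

lemma run_build:
  fixes k :: nat
  defines "V \<equiv> pverts (reduced G k)"
  defines "h \<equiv> enumeration (2 * n) V"
  assumes "0 < n"
    and \<Gamma>: "\<Gamma> 0 = input_store G k 0" "\<Gamma> 1 = input_store G k 1" "\<forall>i<n. \<Gamma> 4 i = i * n"
    "\<Gamma> 13 0 = card V" "\<forall>p<card V. \<Gamma> 14 p = h p" "\<Gamma> 15 0 = card V * card V"
  shows "\<exists>\<Gamma>'. runs build \<Gamma> (20 * (4 * (n * n) + 1)\<^sup>2) \<Gamma>' \<and> \<Gamma>' 0 = \<Gamma> 0 \<and> \<Gamma>' 13 = \<Gamma> 13 \<and>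
    (\<forall>i<card V. \<forall>j<card V. \<Gamma>' 1 (i * card V + j) = of_bool ((h i, h j) \<in> parcs (reduced G k)))"
proof -
  define m where "m = card V"
  define z where "z = 4 * (n * n)"
  have m: "m \<le> 2 * n"
    unfolding m_def V_def by (rule card_reduced_le_double)
  have z: "m * m \<le> z" "m \<le> z" "Suc 0 \<le> z"
    using mult_le_mono[OF m m] m le_square[of n] \<open>0 < n\<close> unfolding z_def by linarith+
  have hV: "h p \<in> V" if "p < m" for p
    using bij_betw_enumeration[of V "2 * n"] reduced_subset[of k] that
    by (auto simp: h_def V_def m_def dest!: bij_betw_imp_surj_on)
  define r where "r p = (of_bool ((h (p div m), h (p mod m)) \<in> parcs (reduced G k)) :: nat)" for p
  define \<Gamma>1 where "\<Gamma>1 = \<Gamma>(18 := table m (\<lambda>i. i * m) (\<Gamma> 18))"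
  define \<Gamma>2 where "\<Gamma>2 = \<Gamma>1(19 := table (m * m) (\<lambda>p. p div m) (\<Gamma> 19))"
  define \<Gamma>3 where "\<Gamma>3 = \<Gamma>2(20 := table (m * m) r (\<Gamma> 20))"
  define \<Gamma>4 where "\<Gamma>4 = \<Gamma>3(1 := table (m * m) r (\<Gamma> 1))"
  note \<Gamma>_defs = \<Gamma>1_def \<Gamma>2_def \<Gamma>3_def \<Gamma>4_def
  have \<Gamma>': "\<Gamma> 0 0 = n" "\<Gamma> 13 0 = m" "\<Gamma> 15 0 = m * m" "\<And>p. p < m \<Longrightarrow> \<Gamma> 14 p = h p"
    "\<And>i. i < n \<Longrightarrow> \<Gamma> 4 i = i * n"
    "\<And>i j. i < n \<Longrightarrow> j < n \<Longrightarrow> \<Gamma> (Suc 0) (i * n + j) = of_bool ((i, j) \<in> parcs G)"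
    using \<Gamma> by (simp_all add: m_def input_store)
  have div: "p div m < m" "p - p div m * m = p mod m" "p mod m < m" if "p < m * m" for p
  proof -
    have "0 < m"
      using that by (cases m) auto
    with that show "p div m < m" "p - p div m * m = p mod m" "p mod m < m"
      by (simp_all add: less_mult_imp_div_less minus_div_mult_eq_mod)
  qed
  have 1: "runs (tabulate 18 (scalar 13) (scalar 13) row_index) \<Gamma> (5 * (z + 1)\<^sup>2) \<Gamma>1"
    by (rule runs_table[where f = "\<lambda>i j. i" and L = m, OF \<Gamma>1_def])
      (use z in \<open>simp_all add: \<Gamma>_defs \<Gamma>'\<close>)
  have 2: "runs (tabulate 19 (scalar 15) (scalar 13)
        (ble (Add (Cell 18 col_index) (scalar 13)) row_index))
      \<Gamma>1 (5 * (z + 1)\<^sup>2) \<Gamma>2"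
    by (rule runs_table[where f = "\<lambda>i j. of_bool (j * m + m \<le> i)" and L = m, OF \<Gamma>2_def])
      (use z in \<open>simp_all add: \<Gamma>_defs \<Gamma>' sum_of_bool_less card_multiples_le\<close>)
  let ?a = "Cell 14 (Cell 19 row_index)"
  let ?b = "Cell 14 (Sub row_index (Cell 18 (Cell 19 row_index)))"
  let ?e = "bor (band (band (blt ?a num_verts) (blt ?b num_verts)) (arc ?a ?b))
    (bor (beq ?a (Add num_verts ?b)) (beq ?b (Add num_verts ?a)))"
  have 3: "runs (tabulate 20 (scalar 15) (Const 1) ?e) \<Gamma>2 (5 * (z + 1)\<^sup>2) \<Gamma>3"
  proof (rule runs_table[where f = "\<lambda>p j. r p" and L = 1, OF \<Gamma>3_def])
    fix s p j
    assume s: "\<And>c. c \<notin> {2, 3, 20} \<Longrightarrow> s c = \<Gamma>2 c" "s 2 0 = p" and "p < m * m"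
    note d = div[OF \<open>p < m * m\<close>]
    have a: "aval ?a s = h (p div m)" and b: "aval ?b s = h (p mod m)"
      using s \<open>p < m * m\<close> d by (simp_all add: \<Gamma>_defs \<Gamma>')
    \<comment> \<open>Both endpoints lie in \<open>V\<close>, so adjacency in the reduced graph
      comes down to the three cases that the program tests.\<close>
    have "r p = of_bool ((h (p div m), h (p mod m)) \<in> parcs G \<or>
        h (p div m) = n + h (p mod m) \<or> h (p mod m) = n + h (p div m))"
      using hV[OF d(1)] hV[OF d(3)] by (simp add: r_def parcs_reduced V_def)
    moreover have "aval (arc ?a ?b) s = of_bool ((h (p div m), h (p mod m)) \<in> parcs G)"
      if "h (p div m) < n" "h (p mod m) < n"
      using s that unfolding aval_arc a b by (simp add: \<Gamma>_defs \<Gamma>')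
    moreover have "aval num_verts s = n"
      using s by (simp add: \<Gamma>_defs \<Gamma>')
    ultimately show "aval ?e s = r p"
      using arc_less[of "h (p div m)" "h (p mod m)"]
      unfolding aval_bool_ops aval_blt aval.simps(3) a b by auto
  qed (use z in \<open>simp_all add: \<Gamma>_defs \<Gamma>'\<close>)
  have 4: "runs (tabulate 1 (scalar 15) (Const 1) (Cell 20 row_index)) \<Gamma>3 (5 * (z + 1)\<^sup>2) \<Gamma>4"
    by (rule runs_table[where f = "\<lambda>i j. r i" and L = 1, OF \<Gamma>4_def])
      (use z in \<open>simp_all add: \<Gamma>_defs \<Gamma>'\<close>)
  have "runs build \<Gamma> (20 * (z + 1)\<^sup>2) \<Gamma>4"
    unfolding build_def Let_def
    by (rule runs_mono[OF runs_Seq[OF 1 runs_Seq[OF 2 runs_Seq[OF 3 4]]]]) simp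
  moreover have "\<Gamma>4 0 = \<Gamma> 0" "\<Gamma>4 13 = \<Gamma> 13"
    by (simp_all add: \<Gamma>_defs)
  moreover have "\<Gamma>4 1 (i * m + j) = of_bool ((h i, h j) \<in> parcs (reduced G k))"
    if "i < m" "j < m" for i j
  proof -
    have "i * m + j < m * m"
      using that mult_le_mono1[of "Suc i" m m] by simp
    then show ?thesis
      using that by (simp add: \<Gamma>_defs r_def)
  qed
  ultimately show ?thesis
    unfolding m_def z_def by blast
qed

lemma compacted:
  "pverts (compacted G k) = {0..<card (pverts (reduced G k))}"
  "(i, j) \<in> parcs (compacted G k) \<longleftrightarrow>
     i < card (pverts (reduced G k)) \<and> j < card (pverts (reduced G k)) \<and>
     (enumeration (2 * n) (pverts (reduced G k)) i, enumeration (2 * n) (pverts (reduced G k)) j)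
       \<in> parcs (reduced G k)"
  by (auto simp: compacted_def verts Let_def)

lemma simple_compacted: "simple_graph (compacted G k)"
  unfolding simple_graph_iff
  using sym_reduced[of k] irrefl_reduced[of k]
  by (auto simp: compacted sym_def irrefl_def)

lemma compacted_correct:
  "(compacted G k, k) \<in> connected_vertex_cover_problem \<longleftrightarrow>
     (G, k) \<in> connected_vertex_cover_problem"
proof -
  have "(compacted G k, k) \<in> connected_vertex_cover_problem \<longleftrightarrow>
      (reduced G k, k) \<in> connected_vertex_cover_problem"
  proof (rule connected_vertex_cover_problem_iso)
    show "bij_betw (enumeration (2 * n) (pverts (reduced G k)))
        (pverts (compacted G k)) (pverts (reduced G k))"
      unfolding compacted using reduced_subset by (rule bij_betw_enumeration)
    show "parcs (reduced G k) \<subseteq> pverts (reduced G k) \<times> pverts (reduced G k)"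
      by (auto simp: parcs_reduced)
    show "parcs (compacted G k) \<subseteq> pverts (compacted G k) \<times> pverts (compacted G k)"
      and "sym (parcs (compacted G k))"
      using simple_compacted[of k] by (simp_all add: simple_graph_iff)
  qed (auto simp: compacted sym_reduced)
  then show ?thesis
    by (simp add: reduced_correct)
qed

text \<open>Accepting branches are correct by the equivalence of the instances; density enters where
  the program rejects, to rule out a solution. Instances returned unchanged account for the
  alternative bound \<open>k\<close>.\<close>

lemma run_kernel:
  fixes k c :: nat
  assumes density: "\<And>X. X \<subseteq> pverts G \<Longrightarrow> X \<noteq> {} \<Longrightarrow>
      card {nbhd G v \<inter> X | v. v \<in> pverts G} \<le> c * card X"
  defines "D \<equiv> 8 * (c + 1)\<^sup>2 + 2 * c"
  shows "\<exists>t s G' k'. exec (kernel D) (input_store G k) t s \<and> t \<le> 100 * (4 * (n * n) + 1)\<^sup>2 \<and>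
    simple_graph G' \<and> output_in_store s G' k' \<and>
    ((G', k') \<in> connected_vertex_cover_problem \<longleftrightarrow> (G, k) \<in> connected_vertex_cover_problem) \<and>
    k' \<le> k \<and> (card (pverts G') \<le> k \<or> (card (pverts G'))\<^sup>2 \<le> D * k ^ 3)"
proof (cases "n \<le> k")
  case True
  then have "exec (kernel D) (input_store G k) (0 + 1) (input_store G k)"
    unfolding kernel_def by (intro exec.CondFalse exec.Skip) (simp add: input_store)
  moreover have "output_in_store (input_store G k) G k"
    using input_store by (simp add: output_in_store_def verts)
  moreover have "0 + 1 \<le> 100 * (4 * (n * n) + 1)\<^sup>2"
    by simp
  ultimately show ?thesis
    using simple True verts
    by (intro exI[of _ "0 + 1"] exI[of _ "input_store G k"] exI[of _ G] exI[of _ k]) simp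
next
  case False
  define m where "m = card (pverts (reduced G k))"
  define z where "z = 4 * (n * n)"
  obtain \<Gamma> where run: "runs analyse (input_store G k) (70 * (z + 1)\<^sup>2) \<Gamma>"
    and \<Gamma>: "\<Gamma> 0 = input_store G k 0" "\<Gamma> 1 = input_store G k 1" "\<forall>i<n. \<Gamma> 4 i = i * n"
    "\<Gamma> 13 0 = m" "\<forall>p<m. \<Gamma> 14 p = enumeration (2 * n) (pverts (reduced G k)) p"
    "\<Gamma> 15 0 = m * m" "\<Gamma> 17 0 = k * (k * k)"
    using run_analyse[of k] False unfolding m_def z_def by auto
  obtain t1 s1 where 1: "exec analyse (input_store G k) t1 s1" "t1 \<le> 70 * (z + 1)\<^sup>2"
    and s1: "\<forall>b. b \<notin> {2, 3} \<longrightarrow> s1 b = \<Gamma> b"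
    using run unfolding runs_def by blast
  have outer: "aval (Sub num_verts param) (input_store G k) \<noteq> 0"
    using False by (simp add: input_store)
  let ?test = "ble (scalar 15) (scale D (scalar 17))"
  have test: "aval ?test s1 = of_bool (m\<^sup>2 \<le> D * k ^ 3)"
    using s1 \<Gamma> by (simp add: power2_eq_square power3_eq_cube)
  show ?thesis
  proof (cases "m\<^sup>2 \<le> D * k ^ 3")
    case True
    obtain \<Gamma>' where run': "runs build \<Gamma> (20 * (z + 1)\<^sup>2) \<Gamma>'"
      and \<Gamma>': "\<Gamma>' 0 = \<Gamma> 0" "\<Gamma>' 13 = \<Gamma> 13"
      "\<And>i j. i < m \<Longrightarrow> j < m \<Longrightarrow> \<Gamma>' 1 (i * m + j) =
        of_bool ((enumeration (2 * n) (pverts (reduced G k)) i,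
          enumeration (2 * n) (pverts (reduced G k)) j) \<in> parcs (reduced G k))"
      using run_build[of \<Gamma> k] \<Gamma> False unfolding m_def z_def by auto
    obtain t2 s2 where 2: "exec build s1 t2 s2" "t2 \<le> 20 * (z + 1)\<^sup>2"
      and s2: "\<forall>b. b \<notin> {2, 3} \<longrightarrow> s2 b = \<Gamma>' b"
      using run' s1 unfolding runs_def by blast
    \<comment> \<open>The parameter is still in its cell from the input; only the number of vertices
      has to be replaced.\<close>
    define s3 where "s3 = s2(0 := (s2 0)(0 := m))"
    have 3: "exec (Upd 0 (Const 0) (scalar 13)) s2 1 s3"
      using exec.Upd[of 0 "Const 0" "scalar 13" s2] s2 \<Gamma>' \<Gamma> by (simp add: s3_def)
    have "exec (kernel D) (input_store G k) (t1 + (t2 + 1 + 1) + 1) s3"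
      unfolding kernel_def
      by (rule exec.CondTrue[OF outer exec.Seq[OF 1(1) exec.CondTrue[OF _ exec.Seq[OF 2(1) 3]]]])
        (use test True in simp)
    moreover have "t1 + (t2 + 1 + 1) + 1 \<le> 100 * (z + 1)\<^sup>2"
    proof -
      \<comment> \<open>Of the factor 100, the analysis takes 70 and the construction 20; the
        remaining 10 absorb the three single steps.\<close>
      have "3 \<le> 10 * (z + 1)\<^sup>2"
        by (simp add: power2_eq_square)
      with 1(2) 2(2) show ?thesis by linarith
    qed
    moreover have "output_in_store s3 (compacted G k) k"
      using s2 \<Gamma>' \<Gamma> unfolding output_in_store_def
      by (simp add: s3_def compacted input_store flip: m_def)
    ultimately show ?thesis
      using simple_compacted[of k] compacted_correct[of k] True
      unfolding z_def[symmetric]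
      by (intro exI[of _ "t1 + (t2 + 1 + 1) + 1"] exI[of _ s3] exI[of _ "compacted G k"] exI[of _ k])
        (simp add: compacted m_def)
  next
    case large: False
    define s2 where "s2 = s1(0 := (s1 0)(0 := 0))"
    define s3 where "s3 = s2(0 := (s2 0)(1 := 0))"
    define E where "E = (\<lparr>pverts = {}, parcs = {}\<rparr> :: ngraph)"
    have 2: "exec (Upd 0 (Const 0) (Const 0)) s1 1 s2"
      using exec.Upd[of 0 "Const 0" "Const 0" s1] by (simp add: s2_def)
    have 3: "exec (Upd 0 (Const 1) (Const 0)) s2 1 s3"
      using exec.Upd[of 0 "Const 1" "Const 0" s2] by (simp add: s3_def)
    have "exec (kernel D) (input_store G k) (t1 + (1 + 1 + 1) + 1) s3"
      unfolding kernel_def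
      by (rule exec.CondTrue[OF outer exec.Seq[OF 1(1) exec.CondFalse[OF _ exec.Seq[OF 2 3]]]])
        (use test large in simp)
    moreover have "t1 + (1 + 1 + 1) + 1 \<le> 100 * (z + 1)\<^sup>2"
    proof -
      have "4 \<le> 30 * (z + 1)\<^sup>2"
        by (simp add: power2_eq_square)
      with 1(2) show ?thesis by linarith
    qed
    moreover have "simple_graph E" "output_in_store s3 E 0" "card (pverts E) = 0"
      by (auto simp: E_def simple_graph_iff output_in_store_def s2_def s3_def sym_def irrefl_def)
    moreover have "(E, 0) \<notin> connected_vertex_cover_problem"
      by (subst connected_vertex_cover_problem_iff)
        (auto simp: E_def sym_def connected_vertex_cover_def vertex_cover_def connected_on_def)
    moreover have "(G, k) \<notin> connected_vertex_cover_problem"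
    proof
      assume "(G, k) \<in> connected_vertex_cover_problem"
      then obtain T where "connected_vertex_cover G T" "card T \<le> k"
        by (auto simp: connected_vertex_cover_problem_iff[OF sym])
      then have "m\<^sup>2 \<le> D * k ^ 3"
        unfolding m_def D_def using density by (rule card_reduced_le)
      with large show False ..
    qed
    ultimately show ?thesis
      unfolding z_def[symmetric]
      by (intro exI[of _ "t1 + (1 + 1 + 1) + 1"] exI[of _ s3] exI[of _ E] exI[of _ 0]) simp
  qed
qed

end

section \<open>The kernel and its size as a function of the parameter\<close>

theorem theorem4:
  fixes \<C> :: "ngraph set"
  assumes "\<And>G. G \<in> \<C> \<Longrightarrow> simple_graph G"
    and "vc_density_at_most_1 \<C>"
  shows "\<exists>c g. kernel_with_vertices c connected_vertex_cover_problem \<C> g \<and>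
           (\<lambda>k. real (g k)) \<in> O(\<lambda>k. real k powr 1.5)"
proof -
  obtain r :: real where r: "\<forall>G\<in>\<C>. \<forall>X. X \<subseteq> pverts G \<and> X \<noteq> {} \<longrightarrow>
      real (card {nbhd G v \<inter> X | v. v \<in> pverts G}) \<le> r * real (card X)"
    using assms(2) unfolding vc_density_at_most_1_def ..
  \<comment> \<open>The density constant is an arbitrary real, possibly negative; a natural number
    above it keeps the counting in \<open>nat\<close>.\<close>
  define c where "c = nat \<lceil>r\<rceil>"
  have density: "card {nbhd G v \<inter> X | v. v \<in> pverts G} \<le> c * card X"
    if "G \<in> \<C>" "X \<subseteq> pverts G" "X \<noteq> {}" for G X
  proof -
    have "r * real (card X) \<le> real c * real (card X)"
      by (intro mult_right_mono) (simp_all add: c_def real_nat_ceiling_ge)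
    with r[rule_format, OF that(1) conjI[OF that(2,3)]]
    have "real (card {nbhd G v \<inter> X | v. v \<in> pverts G}) \<le> real (c * card X)"
      by simp
    then show ?thesis
      by (simp only: of_nat_le_iff)
  qed
  define D where "D = 8 * (c + 1)\<^sup>2 + 2 * c"
  \<comment> \<open>The summand \<open>k\<close> serves the instances returned unchanged, the root
    those that pass the size test.\<close>
  define g where "g k = k + nat \<lfloor>sqrt (real (D * k ^ 3))\<rfloor>" for k
  \<comment> \<open>The running time \<open>100 * (4 * x + 1)\<^sup>2\<close> as a polynomial in
    \<open>x\<close>; the instance size is at least \<open>n * n\<close>.\<close>
  define p :: "nat poly" where "p = smult 100 ([:1, 4:]\<^sup>2)"
  have "kernel_with_vertices (kernel D) connected_vertex_cover_problem \<C> g"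
    unfolding kernel_with_vertices_def
  proof (intro exI[of _ p] exI[of _ "\<lambda>k. (g k)\<^sup>2 + floorlog 2 k"] ballI allI)
    fix G k
    assume G: "G \<in> \<C>"
    then obtain n where n: "pverts G = {0..<n}"
      using assms(1) by (auto simp: simple_graph_def)
    interpret input_graph G n
      using assms(1)[OF G] n by unfold_locales
    obtain t s G' k' where out: "exec (kernel D) (input_store G k) t s"
      "simple_graph G'" "output_in_store s G' k'"
      "(G', k') \<in> connected_vertex_cover_problem \<longleftrightarrow> (G, k) \<in> connected_vertex_cover_problem"
      and t: "t \<le> 100 * (4 * (n * n) + 1)\<^sup>2" and "k' \<le> k"
      and size: "card (pverts G') \<le> k \<or> (card (pverts G'))\<^sup>2 \<le> D * k ^ 3"
      using run_kernel[OF density[OF G], of k] unfolding D_def by blast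
    have "n * n \<le> instance_size G k"
      by (simp add: instance_size_def n power2_eq_square)
    then have "100 * (4 * (n * n) + 1)\<^sup>2 \<le> poly p (instance_size G k)"
      by (simp add: p_def power_mono)
    with t have "t \<le> poly p (instance_size G k)" by linarith
    moreover have g: "card (pverts G') \<le> g k"
      using size
    proof
      assume "(card (pverts G'))\<^sup>2 \<le> D * k ^ 3"
      then have "(real (card (pverts G')))\<^sup>2 \<le> real (D * k ^ 3)"
        by (simp only: of_nat_le_iff flip: of_nat_power)
      then have "card (pverts G') \<le> nat \<lfloor>sqrt (real (D * k ^ 3))\<rfloor>"
        by (intro le_nat_floor real_le_rsqrt)
      then show ?thesis
        by (simp add: g_def)
    qed (simp add: g_def)
    moreover have "instance_size G' k' \<le> (g k)\<^sup>2 + floorlog 2 k"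
      unfolding instance_size_def
      using g \<open>k' \<le> k\<close> by (intro add_mono power_mono floorlog_mono) simp_all
    ultimately show "\<exists>t s G' k'. exec (kernel D) (input_store G k) t s \<and>
        t \<le> poly p (instance_size G k) \<and> simple_graph G' \<and> output_in_store s G' k' \<and>
        ((G', k') \<in> connected_vertex_cover_problem \<longleftrightarrow> (G, k) \<in> connected_vertex_cover_problem) \<and>
        instance_size G' k' \<le> (g k)\<^sup>2 + floorlog 2 k \<and> card (pverts G') \<le> g k"
      using out by blast
  qed
  moreover have "(\<lambda>k. real (g k)) \<in> O(\<lambda>k. real k powr 1.5)"
  proof (rule bigoI[of _ "1 + sqrt (real D)"], rule eventually_mono[OF eventually_ge_at_top[of 1]])
    fix k :: nat
    assume "1 \<le> k"
    have "real k powr 1 \<le> real k powr 1.5"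
      using \<open>1 \<le> k\<close> by (intro powr_mono) simp_all
    then have "real k \<le> real k powr 1.5"
      by simp
    moreover have "real (nat \<lfloor>sqrt (real (D * k ^ 3))\<rfloor>) \<le> sqrt (real (D * k ^ 3))"
      by (simp add: of_nat_floor)
    moreover have "sqrt (real (D * k ^ 3)) = sqrt (real D) * real k powr 1.5"
    proof -
      have "real k ^ 3 = (real k powr 1.5)\<^sup>2"
        using \<open>1 \<le> k\<close> by (simp add: powr_powr flip: powr_realpow powr_numeral)
      then show ?thesis
        by (simp add: real_sqrt_mult)
    qed
    ultimately have "real (g k) \<le> (1 + sqrt (real D)) * real k powr 1.5"
      unfolding g_def of_nat_add distrib_right mult_1_left by linarith
    then show "norm (real (g k)) \<le> (1 + sqrt (real D)) * norm (real k powr 1.5)"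
      by simp
  qed
  ultimately show ?thesis by blast
qed

end
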